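(* Let $k$ be an algebraically closed field of characteristic zero. Given integers $n \geq 3$ and $r \geq 1$, the Weyl algebra $A_r(k)$ is an epimorphic image of the Yang-Mills algebra $\mathrm{YM}(n)$; that is, there exists a surjective homomorphism of $k$-algebras $\mathrm{YM}(n) \twoheadrightarrow A_r(k)$.
   Context: For an integer $n \geq 2$, let $\mathfrak{f}(n)$ be the free Lie algebra over $k$ on generators $x_1,\dots,x_n$. The Lie Yang-Mills algebra is the quotient $\mathfrak{ym}(n) = \mathfrak{f}(n)/\langle \sum_{i=1}^n [x_i,[x_i,x_j]] : 1 \leq j \leq n\rangle$ by the Lie ideal generated by the indicated elements, and $\mathrm{YM}(n) = \mathcal{U}(\mathfrak{ym}(n))$ is its universal enveloping algebra. $A_r(k)$ is the $r$-th Weyl algebra, generated by $p_1,\dots,p_r,q_1,\dots,q_r$ with the canonical commutation relations ($[p_i,q_j]=\delta_{ij}$, $[p_i,p_j]=[q_i,q_j]=0$). *)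

theory Defs
  imports
    "HOL-Library.Poly_Mapping"
    "HOL-Computational_Algebra.Polynomial"
    "HOL-Algebra.QuotRing"
    "HOL-Algebra.Module"
begin

text \<open>
  All algebras over the field \<open>'k\<close> (Lie, associative, or without any axiom on the product) are
  records of type \<open>('k, 'a) module\<close>. The product of a Lie algebra is its bracket, so \<open>[x, y]\<close> is
  written \<open>x \<otimes> y\<close> there; the component \<open>one\<close> is meaningful only for unital algebras and is set to
  zero otherwise.
\<close>

subsection \<open>Ideals, quotients and homomorphisms\<close>

text \<open>
  Two-sided ideals of an algebra that need be neither associative nor unital (the library's
  \<open>ideal\<close> presupposes a ring). For a Lie algebra these are the Lie ideals, for a unital
  associative algebra the ring ideals.
\<close>
definition alg_ideal :: "'a set \<Rightarrow> ('k, 'a) module \<Rightarrow> bool" where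
  "alg_ideal I A \<longleftrightarrow> additive_subgroup I A \<and>
     (\<forall>c. \<forall>x\<in>I. c \<odot>\<^bsub>A\<^esub> x \<in> I) \<and>
     (\<forall>a\<in>carrier A. \<forall>x\<in>I. a \<otimes>\<^bsub>A\<^esub> x \<in> I \<and> x \<otimes>\<^bsub>A\<^esub> a \<in> I)"

definition gen_ideal :: "('k, 'a) module \<Rightarrow> 'a set \<Rightarrow> 'a set" where
  "gen_ideal A S = \<Inter>{I. alg_ideal I A \<and> S \<subseteq> I}"

text \<open>The quotient of \<open>A\<close> by the ideal generated by \<open>S\<close>, and the class of an element in it.\<close>

definition quot_by :: "('k, 'a) module \<Rightarrow> 'a set \<Rightarrow> ('k, 'a set) module" where
  "quot_by A S = (let I = gen_ideal A S in
     ring.extend (A Quot I) (module.fields (\<lambda>c C. \<Union>x\<in>C. I +>\<^bsub>A\<^esub> (c \<odot>\<^bsub>A\<^esub> x))))"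

definition class_by :: "('k, 'a) module \<Rightarrow> 'a set \<Rightarrow> 'a \<Rightarrow> 'a set" where
  "class_by A S a = gen_ideal A S +>\<^bsub>A\<^esub> a"

definition commutator :: "('k, 'a) module \<Rightarrow> 'a \<Rightarrow> 'a \<Rightarrow> 'a" where
  "commutator A a b = a \<otimes>\<^bsub>A\<^esub> b \<ominus>\<^bsub>A\<^esub> b \<otimes>\<^bsub>A\<^esub> a"

text \<open>Homomorphisms of unital \<open>'k\<close>-algebras.\<close>

definition alg_hom :: "('k, 'a) module \<Rightarrow> ('k, 'b) module \<Rightarrow> ('a \<Rightarrow> 'b) set" where
  "alg_hom A B = {f \<in> ring_hom A B. \<forall>c. \<forall>x\<in>carrier A. f (c \<odot>\<^bsub>A\<^esub> x) = c \<odot>\<^bsub>B\<^esub> f x}"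

subsection \<open>Free algebras\<close>

text \<open>
  Bilinear extension of an operation on basis elements to formal linear combinations. (The
  multiplication provided by \<open>Poly_Mapping\<close> is only for additive monoids.)
\<close>
definition conv ::
  "('m \<Rightarrow> 'm \<Rightarrow> 'm) \<Rightarrow> ('m \<Rightarrow>\<^sub>0 'k) \<Rightarrow> ('m \<Rightarrow>\<^sub>0 'k) \<Rightarrow> ('m \<Rightarrow>\<^sub>0 'k::field)" where
  "conv op a b = (\<Sum>s\<in>Poly_Mapping.keys a. \<Sum>t\<in>Poly_Mapping.keys b.
     Poly_Mapping.single (op s t) (Poly_Mapping.lookup a s * Poly_Mapping.lookup b t))"

text \<open>The free unital associative algebra on the set \<open>X\<close>; its basis consists of the words over \<open>X\<close>.\<close>

definition free_assoc :: "'x set \<Rightarrow> ('k::field, 'x list \<Rightarrow>\<^sub>0 'k) module" where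
  "free_assoc X =
     \<lparr>carrier = {a. Poly_Mapping.keys a \<subseteq> lists X},
      mult = conv (@), one = Poly_Mapping.single [] 1,
      zero = 0, add = (+), smult = (\<lambda>c. Poly_Mapping.map ((*) c))\<rparr>"

definition assoc_var :: "'x \<Rightarrow> ('x list \<Rightarrow>\<^sub>0 'k::field)" where
  "assoc_var x = Poly_Mapping.single [x] 1"

text \<open>The free magma on a set, and the free nonassociative nonunital algebra spanned by it.\<close>

datatype (leaves: 'x) magma = Leaf 'x | Prod "'x magma" "'x magma"

definition free_nonassoc :: "'x set \<Rightarrow> ('k::field, 'x magma \<Rightarrow>\<^sub>0 'k) module" where
  "free_nonassoc X =
     \<lparr>carrier = {a. \<forall>t\<in>Poly_Mapping.keys a. leaves t \<subseteq> X},
      mult = conv Prod, one = 0,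
      zero = 0, add = (+), smult = (\<lambda>c. Poly_Mapping.map ((*) c))\<rparr>"

text \<open>The free Lie algebra: impose \<open>[a, a] = 0\<close> and the Jacobi identity.\<close>

definition lie_axioms :: "('k, 'a) module \<Rightarrow> 'a set" where
  "lie_axioms A =
     {a \<otimes>\<^bsub>A\<^esub> a | a. a \<in> carrier A} \<union>
     {a \<otimes>\<^bsub>A\<^esub> (b \<otimes>\<^bsub>A\<^esub> c) \<oplus>\<^bsub>A\<^esub> b \<otimes>\<^bsub>A\<^esub> (c \<otimes>\<^bsub>A\<^esub> a) \<oplus>\<^bsub>A\<^esub> c \<otimes>\<^bsub>A\<^esub> (a \<otimes>\<^bsub>A\<^esub> b) | a b c.
        a \<in> carrier A \<and> b \<in> carrier A \<and> c \<in> carrier A}"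

definition free_lie :: "'x set \<Rightarrow> ('k::field, ('x magma \<Rightarrow>\<^sub>0 'k) set) module" where
  "free_lie X = quot_by (free_nonassoc X) (lie_axioms (free_nonassoc X))"

definition lie_var :: "'x set \<Rightarrow> 'x \<Rightarrow> ('x magma \<Rightarrow>\<^sub>0 'k::field) set" where
  "lie_var X x = class_by (free_nonassoc X) (lie_axioms (free_nonassoc X))
     (Poly_Mapping.single (Leaf x) 1)"

subsection \<open>Universal enveloping algebras\<close>

text \<open>
  The tensor algebra of the vector space underlying \<open>L\<close>, obtained from the free associative algebra
  on the set \<open>carrier L\<close> by making the inclusion of \<open>carrier L\<close> linear.
\<close>
definition tensor_relations :: "('k::field, 'a) module \<Rightarrow> ('a list \<Rightarrow>\<^sub>0 'k) set" where
  "tensor_relations L = (let F = free_assoc (carrier L) in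
     {assoc_var (x \<oplus>\<^bsub>L\<^esub> y) \<ominus>\<^bsub>F\<^esub> (assoc_var x \<oplus>\<^bsub>F\<^esub> assoc_var y) | x y.
        x \<in> carrier L \<and> y \<in> carrier L} \<union>
     {assoc_var (c \<odot>\<^bsub>L\<^esub> x) \<ominus>\<^bsub>F\<^esub> (c \<odot>\<^bsub>F\<^esub> assoc_var x) | c x. x \<in> carrier L})"

definition tensor_alg :: "('k::field, 'a) module \<Rightarrow> ('k, ('a list \<Rightarrow>\<^sub>0 'k) set) module" where
  "tensor_alg L = quot_by (free_assoc (carrier L)) (tensor_relations L)"

definition tensor_var :: "('k::field, 'a) module \<Rightarrow> 'a \<Rightarrow> ('a list \<Rightarrow>\<^sub>0 'k) set" where
  "tensor_var L x = class_by (free_assoc (carrier L)) (tensor_relations L) (assoc_var x)"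

definition env_relations :: "('k::field, 'a) module \<Rightarrow> ('a list \<Rightarrow>\<^sub>0 'k) set set" where
  "env_relations L = (let T = tensor_alg L; \<iota> = tensor_var L in
     {commutator T (\<iota> x) (\<iota> y) \<ominus>\<^bsub>T\<^esub> \<iota> (x \<otimes>\<^bsub>L\<^esub> y) | x y.
        x \<in> carrier L \<and> y \<in> carrier L})"

definition univ_env :: "('k::field, 'a) module \<Rightarrow> ('k, ('a list \<Rightarrow>\<^sub>0 'k) set set) module" where
  "univ_env L = quot_by (tensor_alg L) (env_relations L)"

subsection \<open>Yang-Mills algebras\<close>

type_synonym 'k ym_elem = "(nat magma \<Rightarrow>\<^sub>0 'k) set set"

definition ym_relations :: "nat \<Rightarrow> (nat magma \<Rightarrow>\<^sub>0 'k::field) set set" where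
  "ym_relations n = (let L = free_lie {1..n}; x = lie_var {1..n} in
     {(\<Oplus>\<^bsub>L\<^esub>i\<in>{1..n}. x i \<otimes>\<^bsub>L\<^esub> (x i \<otimes>\<^bsub>L\<^esub> x j)) | j. j \<in> {1..n}})"

definition lie_yang_mills :: "nat \<Rightarrow> ('k::field, 'k ym_elem) module" where
  "lie_yang_mills n = quot_by (free_lie {1..n}) (ym_relations n)"

definition yang_mills :: "nat \<Rightarrow> ('k::field, ('k ym_elem list \<Rightarrow>\<^sub>0 'k) set set) module" where
  "yang_mills n = univ_env (lie_yang_mills n)"

subsection \<open>Weyl algebras\<close>

datatype weyl_gen = P nat | Q nat

definition weyl_gens :: "nat \<Rightarrow> weyl_gen set" where
  "weyl_gens r = P ` {1..r} \<union> Q ` {1..r}"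

definition weyl_relations :: "nat \<Rightarrow> (weyl_gen list \<Rightarrow>\<^sub>0 'k::field) set" where
  "weyl_relations r = (let F = free_assoc (weyl_gens r);
       p = (\<lambda>i. assoc_var (P i)); q = (\<lambda>i. assoc_var (Q i)) in
     {commutator F (p i) (q j) \<ominus>\<^bsub>F\<^esub> (if i = j then \<one>\<^bsub>F\<^esub> else \<zero>\<^bsub>F\<^esub>) | i j.
        i \<in> {1..r} \<and> j \<in> {1..r}} \<union>
     {commutator F (p i) (p j) | i j. i \<in> {1..r} \<and> j \<in> {1..r}} \<union>
     {commutator F (q i) (q j) | i j. i \<in> {1..r} \<and> j \<in> {1..r}})"

definition weyl_algebra :: "nat \<Rightarrow> ('k::field, (weyl_gen list \<Rightarrow>\<^sub>0 'k) set) module" where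
  "weyl_algebra r = quot_by (free_assoc (weyl_gens r)) (weyl_relations r)"

end

theory Submission
  imports Defs
begin

text \<open>
  The homomorphism comes from a null direction of the quadratic form behind the Yang-Mills relations.
  Choose \<open>\<iota>\<close> with \<open>\<iota>\<^sup>2 = -1\<close>, send \<open>x\<^sub>1, x\<^sub>2, x\<^sub>3\<close> to \<open>v, \<iota>v, w\<close> and all further generators to
  zero. In \<open>\<Sum>\<^sub>i [x\<^sub>i, [x\<^sub>i, x\<^sub>j]]\<close> the terms of \<open>x\<^sub>1\<close> and \<open>x\<^sub>2\<close> cancel, since
  \<open>(ad v)\<^sup>2 + (ad \<iota>v)\<^sup>2 = 0\<close>. What remains is \<open>[w, [w, x\<^sub>j]]\<close>, and it vanishes for every \<open>j\<close> as soon as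
  \<open>[w, [w, v]] = 0\<close> (\<open>null_ym_tuple_relation\<close>). So it suffices to find two elements of the Weyl algebra
  that generate it and satisfy this one equation (\<open>weyl_two_generators\<close>).

  For \<open>r = 1\<close> these are \<open>v = p\<close> and \<open>w = q\<close>. For \<open>r \<ge> 2\<close> they are \<open>v = \<Sum>\<^sub>i i q\<^sub>i p\<^sub>i\<close> and
  \<open>w = \<Sum>\<^sub>i (q\<^sub>i + c\<^sub>i p\<^sub>i)\<close>. The derivation \<open>ad v\<close> multiplies \<open>q\<^sub>i\<close> by \<open>i\<close> and \<open>p\<^sub>i\<close> by \<open>-i\<close>, so \<open>w\<close> is a sum of
  eigenvectors with pairwise distinct eigenvalues; a subalgebra that contains \<open>v\<close> and \<open>w\<close> therefore
  contains each \<open>q\<^sub>i\<close> and \<open>c\<^sub>i p\<^sub>i\<close> (\<open>eigencomponents_in_subalgebra\<close>). On the other hand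
  \<open>[w, [w, v]]\<close> is the scalar \<open>-2 \<Sum>\<^sub>i i c\<^sub>i\<close>, and two or more nonzero \<open>c\<^sub>i\<close> can be chosen to make it zero.

  That elements of an associative algebra which satisfy the Yang-Mills relations define a
  homomorphism is a chain of universal properties: from the free nonassociative algebra to the free Lie
  algebra (\<open>free_lie_hom\<close>), on to its quotient (\<open>lie_yang_mills_hom\<close>), and from that Lie algebra to its
  enveloping algebra (\<open>univ_env_hom\<close>). Each link is an instance of one lemma on quotients of algebras
  whose product need be neither associative nor unital (\<open>lift\<close>).
\<close>

section \<open>Nonassociative algebras and their quotients\<close>

text \<open>Lie brackets and associative products share this interface, so that quotients and their
  homomorphisms are treated once. The component \<open>one\<close> of the record is left unconstrained.\<close>

locale nonassoc_algebra = abelian_group A for A :: "('k::field, 'a) module" (structure) +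
  assumes prod_closed: "x \<in> carrier A \<Longrightarrow> y \<in> carrier A \<Longrightarrow> x \<otimes> y \<in> carrier A"
    and prod_add_left: "x \<in> carrier A \<Longrightarrow> y \<in> carrier A \<Longrightarrow> z \<in> carrier A \<Longrightarrow>
      (x \<oplus> y) \<otimes> z = x \<otimes> z \<oplus> y \<otimes> z"
    and prod_add_right: "x \<in> carrier A \<Longrightarrow> y \<in> carrier A \<Longrightarrow> z \<in> carrier A \<Longrightarrow>
      z \<otimes> (x \<oplus> y) = z \<otimes> x \<oplus> z \<otimes> y"
    and scal_closed: "x \<in> carrier A \<Longrightarrow> c \<odot> x \<in> carrier A"
    and scal_add_right: "x \<in> carrier A \<Longrightarrow> y \<in> carrier A \<Longrightarrow> c \<odot> (x \<oplus> y) = c \<odot> x \<oplus> c \<odot> y"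
    and scal_add_left: "x \<in> carrier A \<Longrightarrow> (c + d) \<odot> x = c \<odot> x \<oplus> d \<odot> x"
    and scal_scal: "x \<in> carrier A \<Longrightarrow> c \<odot> (d \<odot> x) = (c * d) \<odot> x"
    and scal_one: "x \<in> carrier A \<Longrightarrow> 1 \<odot> x = x"
    and scal_prod_left: "x \<in> carrier A \<Longrightarrow> y \<in> carrier A \<Longrightarrow> (c \<odot> x) \<otimes> y = c \<odot> (x \<otimes> y)"
    and scal_prod_right: "x \<in> carrier A \<Longrightarrow> y \<in> carrier A \<Longrightarrow> x \<otimes> (c \<odot> y) = c \<odot> (x \<otimes> y)"

definition nonassoc_hom :: "('k, 'a) module \<Rightarrow> ('k, 'b) module \<Rightarrow> ('a \<Rightarrow> 'b) set" where
  "nonassoc_hom A B = {f \<in> carrier A \<rightarrow> carrier B.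
     (\<forall>x\<in>carrier A. \<forall>y\<in>carrier A. f (x \<otimes>\<^bsub>A\<^esub> y) = f x \<otimes>\<^bsub>B\<^esub> f y \<and> f (x \<oplus>\<^bsub>A\<^esub> y) = f x \<oplus>\<^bsub>B\<^esub> f y) \<and>
     (\<forall>c. \<forall>x\<in>carrier A. f (c \<odot>\<^bsub>A\<^esub> x) = c \<odot>\<^bsub>B\<^esub> f x)}"

lemma nonassoc_homD:
  assumes "f \<in> nonassoc_hom A B"
  shows "x \<in> carrier A \<Longrightarrow> f x \<in> carrier B"
    and "x \<in> carrier A \<Longrightarrow> y \<in> carrier A \<Longrightarrow> f (x \<otimes>\<^bsub>A\<^esub> y) = f x \<otimes>\<^bsub>B\<^esub> f y"
    and "x \<in> carrier A \<Longrightarrow> y \<in> carrier A \<Longrightarrow> f (x \<oplus>\<^bsub>A\<^esub> y) = f x \<oplus>\<^bsub>B\<^esub> f y"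
    and "x \<in> carrier A \<Longrightarrow> f (c \<odot>\<^bsub>A\<^esub> x) = c \<odot>\<^bsub>B\<^esub> f x"
  using assms unfolding nonassoc_hom_def by auto

lemma additive_group_hom:
  assumes "abelian_group A" "abelian_group B" "\<And>x. x \<in> carrier A \<Longrightarrow> f x \<in> carrier B"
    "\<And>x y. x \<in> carrier A \<Longrightarrow> y \<in> carrier A \<Longrightarrow> f (x \<oplus>\<^bsub>A\<^esub> y) = f x \<oplus>\<^bsub>B\<^esub> f y"
  shows "abelian_group_hom A B f"
  using assms by (intro abelian_group_homI group_hom.intro group_hom_axioms.intro homI)
    (auto simp: abelian_group.a_group)

lemma (in abelian_group_hom) hom_finsum:
  assumes "\<And>i. i \<in> I \<Longrightarrow> g i \<in> carrier G"
  shows "h (\<Oplus>\<^bsub>G\<^esub>i\<in>I. g i) = (\<Oplus>\<^bsub>H\<^esub>i\<in>I. h (g i))"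
  using assms by (induct I rule: infinite_finite_induct) (auto simp: Pi_def)

lemma (in abelian_group_hom) hom_minus:
  assumes "x \<in> carrier G" "y \<in> carrier G"
  shows "h (x \<ominus>\<^bsub>G\<^esub> y) = h x \<ominus>\<^bsub>H\<^esub> h y"
  using assms by (simp add: a_minus_def)

lemma (in abelian_group) minus_zero_imp_eq:
  assumes "x \<in> carrier G" "y \<in> carrier G" "x \<ominus> y = \<zero>"
  shows "x = y"
  using assms minus_equality[of x "\<ominus> y"] by (simp add: a_minus_def)

lemma nonassoc_hom_abelian_group_hom:
  assumes "nonassoc_algebra A" "nonassoc_algebra B" "f \<in> nonassoc_hom A B"
  shows "abelian_group_hom A B f"
  by (rule additive_group_hom)
    (simp_all add: assms(1,2)[THEN nonassoc_algebra.axioms(1)] nonassoc_homD[OF assms(3)])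

context nonassoc_algebra
begin

lemma prod_left_hom: "y \<in> carrier A \<Longrightarrow> abelian_group_hom A A (\<lambda>x. x \<otimes> y)"
  by (intro additive_group_hom abelian_group_axioms) (auto simp: prod_closed prod_add_left)

lemma prod_right_hom: "y \<in> carrier A \<Longrightarrow> abelian_group_hom A A (\<lambda>x. y \<otimes> x)"
  by (intro additive_group_hom abelian_group_axioms) (auto simp: prod_closed prod_add_right)

lemma scal_hom: "abelian_group_hom A A (\<lambda>x. c \<odot> x)"
  by (intro additive_group_hom abelian_group_axioms) (auto simp: scal_closed scal_add_right)

lemma prod_zero_left: "x \<in> carrier A \<Longrightarrow> \<zero> \<otimes> x = \<zero>"
  using abelian_group_hom.hom_zero[OF prod_left_hom] .

lemma prod_zero_right: "x \<in> carrier A \<Longrightarrow> x \<otimes> \<zero> = \<zero>"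
  using abelian_group_hom.hom_zero[OF prod_right_hom] .

lemma scal_zero_right: "c \<odot> \<zero> = \<zero>"
  using abelian_group_hom.hom_zero[OF scal_hom] .

lemma scal_zero_left: "x \<in> carrier A \<Longrightarrow> 0 \<odot> x = \<zero>"
  using scal_add_left[of x 0 0] scal_closed[of x 0] add.l_cancel_one'[of "0 \<odot> x" "0 \<odot> x"] by simp

lemma scal_uminus: "x \<in> carrier A \<Longrightarrow> (- c) \<odot> x = \<ominus> (c \<odot> x)"
  using scal_add_left[of x "- c" c] scal_closed minus_equality[of "(- c) \<odot> x" "c \<odot> x"]
  by (simp add: scal_zero_left)

lemma minus_as_scal: "x \<in> carrier A \<Longrightarrow> y \<in> carrier A \<Longrightarrow> x \<ominus> y = x \<oplus> (- 1) \<odot> y"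
  by (simp add: a_minus_def scal_uminus scal_one)

lemma scal_finsum:
  assumes "\<And>i. i \<in> I \<Longrightarrow> g i \<in> carrier A"
  shows "c \<odot> (\<Oplus>i\<in>I. g i) = (\<Oplus>i\<in>I. c \<odot> g i)"
  using abelian_group_hom.hom_finsum[OF scal_hom] assms .

lemma finsum_prod_left:
  assumes "\<And>i. i \<in> I \<Longrightarrow> g i \<in> carrier A" "y \<in> carrier A"
  shows "(\<Oplus>i\<in>I. g i) \<otimes> y = (\<Oplus>i\<in>I. g i \<otimes> y)"
  using abelian_group_hom.hom_finsum[OF prod_left_hom] assms by blast

lemma finsum_prod_right:
  assumes "\<And>i. i \<in> I \<Longrightarrow> g i \<in> carrier A" "y \<in> carrier A"
  shows "y \<otimes> (\<Oplus>i\<in>I. g i) = (\<Oplus>i\<in>I. y \<otimes> g i)"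
  using abelian_group_hom.hom_finsum[OF prod_right_hom] assms by blast

lemma carrier_ideal: "alg_ideal (carrier A) A"
  unfolding alg_ideal_def
  by (auto intro!: additive_subgroup.intro add.subgroup_self prod_closed scal_closed)

lemma gen_ideal_ideal:
  assumes "S \<subseteq> carrier A"
  shows "alg_ideal (gen_ideal A S) A"
proof -
  let ?F = "{I. alg_ideal I A \<and> S \<subseteq> I}"
  have mem: "x \<in> gen_ideal A S \<longleftrightarrow> (\<forall>I\<in>?F. x \<in> I)" for x by (simp add: gen_ideal_def)
  have car: "carrier A \<in> ?F" using carrier_ideal assms by simp
  have sub: "additive_subgroup I A" if "I \<in> ?F" for I using that by (simp add: alg_ideal_def)
  have "additive_subgroup (gen_ideal A S) A"
    unfolding gen_ideal_def
    by (rule additive_subgroupI, rule add.subgroups_Inter)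
      (use car sub in \<open>auto simp: additive_subgroup.a_subgroup\<close>)
  moreover have "c \<odot> x \<in> gen_ideal A S" if "x \<in> gen_ideal A S" for c x
    using that by (auto simp: mem alg_ideal_def)
  moreover have "a \<otimes> x \<in> gen_ideal A S" "x \<otimes> a \<in> gen_ideal A S"
    if "x \<in> gen_ideal A S" "a \<in> carrier A" for a x
    using that by (auto simp: mem alg_ideal_def)
  ultimately show ?thesis by (auto simp: alg_ideal_def)
qed

lemma subset_gen_ideal: "S \<subseteq> gen_ideal A S"
  by (auto simp: gen_ideal_def)

lemma ideal_abelian_subgroup: "alg_ideal I A \<Longrightarrow> abelian_subgroup I A"
  using abelian_subgroupI3[OF _ abelian_group_axioms] by (simp add: alg_ideal_def)

end

lemma hom_kernel_ideal:
  assumes A: "nonassoc_algebra A" and B: "nonassoc_algebra B" and f: "f \<in> nonassoc_hom A B"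
  shows "alg_ideal {x \<in> carrier A. f x = \<zero>\<^bsub>B\<^esub>} A"
proof -
  interpret A: nonassoc_algebra A by fact
  interpret B: nonassoc_algebra B by fact
  interpret f: abelian_group_hom A B f by (rule nonassoc_hom_abelian_group_hom[OF A B f])
  have "additive_subgroup {x \<in> carrier A. f x = \<zero>\<^bsub>B\<^esub>} A"
    using f.additive_subgroup_a_kernel unfolding a_kernel_def' .
  then show ?thesis
    by (simp add: alg_ideal_def nonassoc_homD[OF f] A.scal_closed A.prod_closed B.scal_zero_right
        B.prod_zero_left B.prod_zero_right)
qed

locale algebra_quotient = nonassoc_algebra A for A :: "('k::field, 'a) module" (structure) +
  fixes S assumes gens_closed: "S \<subseteq> carrier A"
begin

abbreviation I where "I \<equiv> gen_ideal A S"
abbreviation cls where "cls \<equiv> class_by A S"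
abbreviation B where "B \<equiv> quot_by A S"

lemma I_ideal: "alg_ideal I A" by (rule gen_ideal_ideal[OF gens_closed])

sublocale I: abelian_subgroup I A by (rule ideal_abelian_subgroup[OF I_ideal])

lemma class_eq_iff:
  assumes "x \<in> carrier A" "y \<in> carrier A"
  shows "cls x = cls y \<longleftrightarrow> x \<ominus> y \<in> I"
proof -
  have "cls x = cls y \<longleftrightarrow> x \<in> I +> y"
    unfolding class_by_def using I.a_rcos_self[OF assms(1)] I.a_repr_independence'[OF _ assms(2)] by blast
  then show ?thesis using I.a_rcos_module[OF assms(2,1)] by (simp add: a_minus_def)
qed

lemma class_memD:
  assumes "x \<in> carrier A" "x' \<in> cls x"
  shows "x' \<in> carrier A" "cls x' = cls x"
  using assms I.a_elemrcos_carrier[of x x'] I.a_repr_independence'[of x' x] unfolding class_by_def by simp_all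

lemma class_self: "x \<in> carrier A \<Longrightarrow> x \<in> cls x"
  unfolding class_by_def by (rule I.a_rcos_self)

lemma quot_carrier: "carrier B = cls ` carrier A"
  by (auto simp: quot_by_def Let_def ring.defs module.defs FactRing_def A_RCOSETS_def' class_by_def)

lemma quot_add:
  assumes "x \<in> carrier A" "y \<in> carrier A"
  shows "cls x \<oplus>\<^bsub>B\<^esub> cls y = cls (x \<oplus> y)"
  using I.a_rcos_sum[OF assms]
  by (simp add: quot_by_def Let_def ring.defs module.defs FactRing_def class_by_def)

lemma quot_zero: "\<zero>\<^bsub>B\<^esub> = cls \<zero>"
  using I.a_rcos_const[OF I.zero_closed]
  by (simp add: quot_by_def Let_def ring.defs module.defs FactRing_def class_by_def)

lemma quot_one: "\<one>\<^bsub>B\<^esub> = cls \<one>"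
  by (simp add: quot_by_def Let_def ring.defs module.defs FactRing_def class_by_def)

text \<open>The quotient operations are unions over all representatives of a class. The next two lemmas make
  the members of these unions equal: \<open>c \<odot> x' \<ominus> c \<odot> x = c \<odot> (x' \<ominus> x)\<close> and
  \<open>x' \<otimes> y' \<ominus> x \<otimes> y = (x' \<ominus> x) \<otimes> y' \<oplus> x \<otimes> (y' \<ominus> y)\<close> lie in the ideal.\<close>

lemma class_cong_scal:
  assumes "x \<in> carrier A" "x' \<in> cls x"
  shows "cls (c \<odot> x') = cls (c \<odot> x)"
proof -
  note x' = class_memD[OF assms]
  then have "x' \<ominus> x \<in> I" using class_eq_iff assms(1) by blast
  then have "c \<odot> (x' \<ominus> x) \<in> I" using I_ideal by (auto simp: alg_ideal_def)
  then have "c \<odot> x' \<ominus> c \<odot> x \<in> I"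
    using abelian_group_hom.hom_minus[OF scal_hom x'(1) assms(1), of c] by simp
  then show ?thesis using class_eq_iff x'(1) assms(1) scal_closed by simp
qed

lemma class_cong_prod:
  assumes "x \<in> carrier A" "x' \<in> cls x" "y \<in> carrier A" "y' \<in> cls y"
  shows "cls (x' \<otimes> y') = cls (x \<otimes> y)"
proof -
  note x' = class_memD[OF assms(1,2)] and y' = class_memD[OF assms(3,4)]
  have "x' \<ominus> x \<in> I" "y' \<ominus> y \<in> I" using class_eq_iff x' y' assms(1,3) by blast+
  then have "(x' \<ominus> x) \<otimes> y' \<in> I" "x \<otimes> (y' \<ominus> y) \<in> I"
    using I_ideal y'(1) assms(1) by (auto simp: alg_ideal_def)
  then have "x' \<otimes> y' \<ominus> x \<otimes> y' \<in> I" "x \<otimes> y' \<ominus> x \<otimes> y \<in> I"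
    using abelian_group_hom.hom_minus[OF prod_left_hom[OF y'(1)] x'(1) assms(1)]
      abelian_group_hom.hom_minus[OF prod_right_hom[OF assms(1)] y'(1) assms(3)] by simp_all
  then show ?thesis using class_eq_iff x'(1) y'(1) assms(1,3) prod_closed by metis
qed

lemma quot_mult:
  assumes "x \<in> carrier A" "y \<in> carrier A"
  shows "cls x \<otimes>\<^bsub>B\<^esub> cls y = cls (x \<otimes> y)"
proof -
  have "cls x \<otimes>\<^bsub>B\<^esub> cls y = (\<Union>a\<in>cls x. \<Union>b\<in>cls y. cls (a \<otimes> b))"
    by (simp add: quot_by_def Let_def ring.defs module.defs FactRing_def class_by_def rcoset_mult_def)
  also have "\<dots> = (\<Union>a\<in>cls x. \<Union>b\<in>cls y. cls (x \<otimes> y))"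
    by (intro SUP_cong refl class_cong_prod assms)
  finally show ?thesis using class_self assms by blast
qed

lemma quot_scal:
  assumes "x \<in> carrier A"
  shows "c \<odot>\<^bsub>B\<^esub> cls x = cls (c \<odot> x)"
proof -
  have "c \<odot>\<^bsub>B\<^esub> cls x = (\<Union>a\<in>cls x. cls (c \<odot> a))"
    by (simp add: quot_by_def Let_def ring.defs module.defs FactRing_def class_by_def)
  also have "\<dots> = (\<Union>a\<in>cls x. cls (c \<odot> x))"
    by (intro SUP_cong refl class_cong_scal assms)
  finally show ?thesis using class_self assms by blast
qed

lemmas quot_simps = quot_add quot_zero quot_one quot_mult quot_scal

lemma quotient_algebra: "nonassoc_algebra B"
proof (intro nonassoc_algebra.intro nonassoc_algebra_axioms.intro abelian_groupI)
  show "\<exists>y\<in>carrier B. y \<oplus>\<^bsub>B\<^esub> x = \<zero>\<^bsub>B\<^esub>" if x: "x \<in> carrier B" for x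
  proof -
    obtain a where a: "a \<in> carrier A" "x = cls a" using x by (auto simp: quot_carrier)
    then have "cls (\<ominus> a) \<in> carrier B" "cls (\<ominus> a) \<oplus>\<^bsub>B\<^esub> x = \<zero>\<^bsub>B\<^esub>"
      by (auto simp: quot_carrier quot_simps l_neg)
    then show ?thesis by blast
  qed
qed (auto simp: quot_carrier quot_simps prod_closed scal_closed a_ac prod_add_left prod_add_right
    scal_add_left scal_add_right scal_scal scal_one scal_prod_left scal_prod_right)

lemma class_hom: "cls \<in> nonassoc_hom A B"
  by (auto simp: nonassoc_hom_def quot_carrier quot_simps)

lemma class_gens: "x \<in> S \<Longrightarrow> cls x = \<zero>\<^bsub>B\<^esub>"
  using I.a_rcos_const subset_gen_ideal[of S]
  by (auto simp: quot_zero class_by_def)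

text \<open>The kernel of \<open>f\<close> is itself an ideal that contains \<open>S\<close>, so it contains the ideal generated by \<open>S\<close>,
  and the value of \<open>f\<close> at any representative of a class is the same.\<close>

lemma lift:
  assumes C: "nonassoc_algebra C" and f: "f \<in> nonassoc_hom A C" and fS: "\<And>x. x \<in> S \<Longrightarrow> f x = \<zero>\<^bsub>C\<^esub>"
  obtains g where "g \<in> nonassoc_hom B C" "\<And>x. x \<in> carrier A \<Longrightarrow> g (cls x) = f x"
proof -
  interpret C: nonassoc_algebra C by fact
  interpret f: abelian_group_hom A C f
    by (rule nonassoc_hom_abelian_group_hom[OF nonassoc_algebra_axioms C f])
  have ker: "I \<subseteq> {x \<in> carrier A. f x = \<zero>\<^bsub>C\<^esub>}"
    using hom_kernel_ideal[OF nonassoc_algebra_axioms C f] fS gens_closed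
    unfolding gen_ideal_def by blast
  have cong: "f x = f y" if "x \<in> carrier A" "y \<in> carrier A" "cls x = cls y" for x y
  proof -
    have "f (x \<ominus> y) = \<zero>\<^bsub>C\<^esub>" using that ker class_eq_iff by blast
    then show ?thesis using C.minus_zero_imp_eq[of "f x" "f y"] that by (simp add: f.hom_minus)
  qed
  \<comment> \<open>Any representative will do, by \<open>cong\<close>.\<close>
  define g where "g X = f (SOME x. x \<in> carrier A \<and> cls x = X)" for X
  have g: "g (cls x) = f x" if "x \<in> carrier A" for x
    using someI[of "\<lambda>y. y \<in> carrier A \<and> cls y = cls x" x] that unfolding g_def by (intro cong) auto
  have "g \<in> nonassoc_hom B C"
    by (auto simp: nonassoc_hom_def quot_carrier quot_simps g prod_closed scal_closed nonassoc_homD[OF f])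
  with g that show thesis by blast
qed

end

section \<open>Free algebras\<close>

text \<open>The span of a set \<open>K\<close> of basis elements closed under \<open>op\<close>: words under concatenation and trees under
  grafting give the two free algebras. The unit is a parameter because trees have none.\<close>

definition magma_algebra ::
  "'m set \<Rightarrow> ('m \<Rightarrow> 'm \<Rightarrow> 'm) \<Rightarrow> ('m \<Rightarrow>\<^sub>0 'k) \<Rightarrow> ('k::field, 'm \<Rightarrow>\<^sub>0 'k) module" where
  "magma_algebra K op e =
     \<lparr>carrier = {a. Poly_Mapping.keys a \<subseteq> K}, mult = conv op, one = e,
      zero = 0, add = (+), smult = (\<lambda>c. Poly_Mapping.map ((*) c))\<rparr>"

lemma free_nonassoc_eq: "free_nonassoc X = magma_algebra {t. leaves t \<subseteq> X} Prod 0"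
  by (auto simp: free_nonassoc_def magma_algebra_def)

lemma free_assoc_eq: "free_assoc X = magma_algebra (lists X) (@) (Poly_Mapping.single [] 1)"
  by (auto simp: free_assoc_def magma_algebra_def)

lemma magma_algebra_simps [simp]:
  "carrier (magma_algebra K op e) = {a. Poly_Mapping.keys a \<subseteq> K}"
  "mult (magma_algebra K op e) = conv op"
  "one (magma_algebra K op e) = e"
  "zero (magma_algebra K op e) = 0"
  "add (magma_algebra K op e) = (+)"
  "smult (magma_algebra K op e) = (\<lambda>c. Poly_Mapping.map ((*) c))"
  by (simp_all add: magma_algebra_def)

lemma lookup_scale: "Poly_Mapping.lookup (Poly_Mapping.map ((*) c) a) s = (c :: 'k::field) * Poly_Mapping.lookup a s"
  by (simp add: Poly_Mapping.map.rep_eq when_def)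

lemma sum_singles:
  assumes "finite A" "Poly_Mapping.keys a \<subseteq> A"
  shows "(\<Sum>s\<in>A. Poly_Mapping.single s (Poly_Mapping.lookup a s)) = (a :: 'm \<Rightarrow>\<^sub>0 'k::field)"
proof (rule poly_mapping_eqI)
  fix k
  show "Poly_Mapping.lookup (\<Sum>s\<in>A. Poly_Mapping.single s (Poly_Mapping.lookup a s)) k = Poly_Mapping.lookup a k"
    using assms by (auto simp: lookup_sum lookup_single when_def in_keys_iff)
qed

lemma keys_add_subset: "Poly_Mapping.keys a \<subseteq> K \<Longrightarrow> Poly_Mapping.keys b \<subseteq> K \<Longrightarrow>
    Poly_Mapping.keys (a + b :: 'm \<Rightarrow>\<^sub>0 'k::field) \<subseteq> K"
  using Poly_Mapping.keys_add[of a b] by blast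

lemma keys_scale_subset: "Poly_Mapping.keys a \<subseteq> K \<Longrightarrow>
    Poly_Mapping.keys (Poly_Mapping.map ((*) c) a :: 'm \<Rightarrow>\<^sub>0 'k::field) \<subseteq> K"
  by (auto simp: in_keys_iff lookup_scale)

lemma keys_sum_subset:
  fixes f :: "'i \<Rightarrow> 'm \<Rightarrow>\<^sub>0 'k::field"
  assumes "\<And>i. i \<in> I \<Longrightarrow> Poly_Mapping.keys (f i) \<subseteq> K"
  shows "Poly_Mapping.keys (\<Sum>i\<in>I. f i) \<subseteq> K"
  using assms by (induct I rule: infinite_finite_induct) (simp_all add: keys_add_subset)

lemma keys_single_subset: "s \<in> K \<Longrightarrow> Poly_Mapping.keys (Poly_Mapping.single s c) \<subseteq> K"
  by simp

lemma keys_conv_subset: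
  fixes a b :: "'m \<Rightarrow>\<^sub>0 'k::field"
  assumes "Poly_Mapping.keys a \<subseteq> K" "Poly_Mapping.keys b \<subseteq> K"
    "\<And>s t. s \<in> K \<Longrightarrow> t \<in> K \<Longrightarrow> op s t \<in> K"
  shows "Poly_Mapping.keys (conv op a b) \<subseteq> K"
  unfolding conv_def using assms by (intro keys_sum_subset keys_single_subset) blast

text \<open>Summing over fixed finite sets that contain the supports, instead of over the supports
  themselves, lets sums of elements with different supports be compared term by term.\<close>

lemma conv_superset:
  fixes a b :: "'m \<Rightarrow>\<^sub>0 'k::field"
  assumes "finite A" "finite B" "Poly_Mapping.keys a \<subseteq> A" "Poly_Mapping.keys b \<subseteq> B"
  shows "conv op a b = (\<Sum>s\<in>A. \<Sum>t\<in>B.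
    Poly_Mapping.single (op s t) (Poly_Mapping.lookup a s * Poly_Mapping.lookup b t))"
proof -
  have "(\<Sum>t\<in>Poly_Mapping.keys b. Poly_Mapping.single (op s t) (Poly_Mapping.lookup a s * Poly_Mapping.lookup b t))
     = (\<Sum>t\<in>B. Poly_Mapping.single (op s t) (Poly_Mapping.lookup a s * Poly_Mapping.lookup b t))" for s
    using assms by (intro sum.mono_neutral_left) (auto simp: in_keys_iff)
  then show ?thesis unfolding conv_def
    using assms by (simp, intro sum.mono_neutral_left) (auto simp: in_keys_iff)
qed

lemma conv_add_left: "conv op (a + b) c = conv op a c + conv op b c"
proof -
  define A where "A = Poly_Mapping.keys a \<union> Poly_Mapping.keys b"
  have A: "finite A" "Poly_Mapping.keys a \<subseteq> A" "Poly_Mapping.keys b \<subseteq> A" "Poly_Mapping.keys (a + b) \<subseteq> A"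
    using Poly_Mapping.keys_add[of a b] by (auto simp: A_def)
  show ?thesis
    unfolding conv_superset[OF A(1) finite_keys A(2) order_refl] conv_superset[OF A(1) finite_keys A(3) order_refl]
      conv_superset[OF A(1) finite_keys A(4) order_refl]
    by (simp add: lookup_add distrib_right single_add sum.distrib)
qed

lemma conv_add_right: "conv op c (a + b) = conv op c a + conv op c b"
proof -
  define A where "A = Poly_Mapping.keys a \<union> Poly_Mapping.keys b"
  have A: "finite A" "Poly_Mapping.keys a \<subseteq> A" "Poly_Mapping.keys b \<subseteq> A" "Poly_Mapping.keys (a + b) \<subseteq> A"
    using Poly_Mapping.keys_add[of a b] by (auto simp: A_def)
  show ?thesis
    unfolding conv_superset[OF finite_keys A(1) order_refl A(2)] conv_superset[OF finite_keys A(1) order_refl A(3)]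
      conv_superset[OF finite_keys A(1) order_refl A(4)]
    by (simp add: lookup_add distrib_left single_add sum.distrib)
qed

lemma conv_zero [simp]: "conv op 0 a = 0" "conv op a 0 = 0"
  by (simp_all add: conv_def)

lemma conv_sum_left: "conv op (\<Sum>i\<in>I. f i) c = (\<Sum>i\<in>I. conv op (f i) c)"
  by (induct I rule: infinite_finite_induct) (auto simp: conv_add_left)

lemma conv_sum_right: "conv op c (\<Sum>i\<in>I. f i) = (\<Sum>i\<in>I. conv op c (f i))"
  by (induct I rule: infinite_finite_induct) (auto simp: conv_add_right)

lemma conv_single_left:
  "conv op (Poly_Mapping.single s x) b =
    (\<Sum>t\<in>Poly_Mapping.keys b. Poly_Mapping.single (op s t) (x * Poly_Mapping.lookup b t))"
  by (subst conv_superset[of "{s}" "Poly_Mapping.keys b"]) auto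

lemma conv_single_right:
  "conv op a (Poly_Mapping.single t x) =
    (\<Sum>s\<in>Poly_Mapping.keys a. Poly_Mapping.single (op s t) (Poly_Mapping.lookup a s * x))"
  by (subst conv_superset[of "Poly_Mapping.keys a" "{t}"]) auto

lemma conv_single_single [simp]:
  "conv op (Poly_Mapping.single s x) (Poly_Mapping.single t y) = Poly_Mapping.single (op s t) (x * y)"
  by (subst conv_superset[of "{s}" "{t}"]) auto

lemma scale_single [simp]:
  "Poly_Mapping.map ((*) c) (Poly_Mapping.single s x) = Poly_Mapping.single s ((c::'k::field) * x)"
  by (rule poly_mapping_eqI) (simp add: lookup_scale lookup_single when_def)

lemma scale_add:
  "Poly_Mapping.map ((*) c) (a + b) = Poly_Mapping.map ((*) (c::'k::field)) a + Poly_Mapping.map ((*) c) b"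
  by (rule poly_mapping_eqI) (simp add: lookup_scale lookup_add distrib_left)

lemma scale_sum:
  "Poly_Mapping.map ((*) c) (\<Sum>i\<in>I. f i) = (\<Sum>i\<in>I. Poly_Mapping.map ((*) (c::'k::field)) (f i))"
  by (rule poly_mapping_eqI) (simp add: lookup_scale lookup_sum sum_distrib_left)

lemma conv_scale_left:
  "conv op (Poly_Mapping.map ((*) c) a) b = Poly_Mapping.map ((*) c) (conv op a b)"
  by (subst conv_superset[OF finite_keys[of a] finite_keys[of b] keys_scale_subset[OF order_refl] order_refl])
    (simp add: conv_def scale_sum lookup_scale mult.assoc)

lemma conv_scale_right:
  "conv op a (Poly_Mapping.map ((*) c) b) = Poly_Mapping.map ((*) c) (conv op a b)"
  by (subst conv_superset[OF finite_keys[of a] finite_keys[of b] order_refl keys_scale_subset[OF order_refl]])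
    (simp add: conv_def scale_sum lookup_scale mult.left_commute)

text \<open>Both sides are linear in each argument, so it is enough to compare them on basis elements.\<close>

lemma conv_assoc:
  assumes "\<And>s t u. op (op s t) u = op s (op t u)"
  shows "conv op (conv op a b) c = conv op a (conv op b c)"
proof -
  have 1: "conv op (Poly_Mapping.single s x) (conv op (Poly_Mapping.single t y) (Poly_Mapping.single u z)) =
      conv op (conv op (Poly_Mapping.single s x) (Poly_Mapping.single t y)) (Poly_Mapping.single u z)" for s t u x y z
    by (simp add: assms mult.assoc)
  show ?thesis
    by (subst (1 2) sum_singles[OF finite_keys order_refl, of a, symmetric],
        subst (1 2) sum_singles[OF finite_keys order_refl, of b, symmetric],
        subst (1 2) sum_singles[OF finite_keys order_refl, of c, symmetric])
      (simp only: conv_sum_left conv_sum_right 1)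
qed

lemma magma_algebra_nonassoc:
  assumes "\<And>s t. s \<in> K \<Longrightarrow> t \<in> K \<Longrightarrow> op s t \<in> K"
  shows "nonassoc_algebra (magma_algebra K op e)"
proof (intro nonassoc_algebra.intro nonassoc_algebra_axioms.intro abelian_groupI)
  show "\<exists>y\<in>carrier (magma_algebra K op e). y \<oplus>\<^bsub>magma_algebra K op e\<^esub> x = \<zero>\<^bsub>magma_algebra K op e\<^esub>"
    if "x \<in> carrier (magma_algebra K op e)" for x
    by (rule bexI[of _ "- x"]) (use that in \<open>auto simp: in_keys_iff\<close>)
qed (use assms in \<open>simp_all add: keys_add_subset keys_scale_subset keys_conv_subset conv_add_left conv_add_right
      conv_scale_left conv_scale_right scale_add add.assoc add.commute\<close>,
    auto intro!: poly_mapping_eqI simp: lookup_scale lookup_add distrib_right)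

lemma free_nonassoc_algebra: "nonassoc_algebra (free_nonassoc X)"
  unfolding free_nonassoc_eq by (rule magma_algebra_nonassoc) auto

locale assoc_algebra = ring A + nonassoc_algebra A for A :: "('k::field, 'a) module" (structure)

lemma free_assoc_algebra: "assoc_algebra (free_assoc X :: ('k::field, 'x list \<Rightarrow>\<^sub>0 'k) module)"
proof -
  let ?F = "free_assoc X :: ('k, 'x list \<Rightarrow>\<^sub>0 'k) module"
  interpret nonassoc_algebra ?F
    unfolding free_assoc_eq by (rule magma_algebra_nonassoc) auto
  have "conv (@) (Poly_Mapping.single [] 1) a = a" "conv (@) a (Poly_Mapping.single [] 1) = a"
    for a :: "'x list \<Rightarrow>\<^sub>0 'k"
    by (simp_all add: conv_single_left conv_single_right sum_singles)
  then have "monoid ?F"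
    by (intro monoidI) (use prod_closed in \<open>auto simp: free_assoc_eq conv_assoc\<close>)
  then show ?thesis
    by (intro assoc_algebra.intro ringI nonassoc_algebra_axioms abelian_group_axioms prod_add_left prod_add_right)
qed

lemma quotient_assoc_algebra:
  assumes "assoc_algebra A" "S \<subseteq> carrier A"
  shows "assoc_algebra (quot_by A S)"
proof -
  interpret assoc_algebra A by fact
  interpret q: algebra_quotient A S by unfold_locales fact
  interpret B: nonassoc_algebra "quot_by A S" by (rule q.quotient_algebra)
  have "monoid (quot_by A S)"
    by (intro monoidI) (auto simp: q.quot_carrier q.quot_simps m_assoc)
  then show ?thesis
    by (intro assoc_algebra.intro ringI B.nonassoc_algebra_axioms B.abelian_group_axioms
        B.prod_add_left B.prod_add_right)
qed

locale linear_extension = nonassoc_algebra B for B :: "('k::field, 'b) module" (structure) +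
  fixes K :: "'m set" and \<phi> :: "'m \<Rightarrow> 'b"
  assumes phi_closed: "s \<in> K \<Longrightarrow> \<phi> s \<in> carrier B"
begin

definition ext :: "('m \<Rightarrow>\<^sub>0 'k) \<Rightarrow> 'b" where
  "ext a = (\<Oplus>s\<in>Poly_Mapping.keys a. Poly_Mapping.lookup a s \<odot> \<phi> s)"

lemma ext_superset:
  assumes "finite J" "Poly_Mapping.keys a \<subseteq> J" "J \<subseteq> K"
  shows "ext a = (\<Oplus>s\<in>J. Poly_Mapping.lookup a s \<odot> \<phi> s)"
  unfolding ext_def using assms
  by (intro add.finprod_mono_neutral_cong_left)
    (auto simp: in_keys_iff scal_zero_left phi_closed scal_closed subset_iff)

lemma ext_closed: "Poly_Mapping.keys a \<subseteq> K \<Longrightarrow> ext a \<in> carrier B"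
  unfolding ext_def by (intro finsum_closed) (auto simp: phi_closed scal_closed)

lemma ext_add:
  assumes "Poly_Mapping.keys a \<subseteq> K" "Poly_Mapping.keys b \<subseteq> K"
  shows "ext (a + b) = ext a \<oplus> ext b"
proof -
  define J where "J = Poly_Mapping.keys a \<union> Poly_Mapping.keys b"
  have J: "finite J" "Poly_Mapping.keys a \<subseteq> J" "Poly_Mapping.keys b \<subseteq> J" "Poly_Mapping.keys (a + b) \<subseteq> J" "J \<subseteq> K"
    using assms Poly_Mapping.keys_add[of a b] by (auto simp: J_def)
  have "s \<in> K" if "s \<in> J" for s using that J(5) by blast
  note closed = this phi_closed scal_closed
  have "(\<Oplus>s\<in>J. Poly_Mapping.lookup (a + b) s \<odot> \<phi> s) =
      (\<Oplus>s\<in>J. Poly_Mapping.lookup a s \<odot> \<phi> s \<oplus> Poly_Mapping.lookup b s \<odot> \<phi> s)"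
    by (intro finsum_cong' refl) (auto simp: lookup_add scal_add_left closed)
  also have "\<dots> = (\<Oplus>s\<in>J. Poly_Mapping.lookup a s \<odot> \<phi> s) \<oplus> (\<Oplus>s\<in>J. Poly_Mapping.lookup b s \<odot> \<phi> s)"
    by (rule finsum_addf) (auto simp: closed)
  finally show ?thesis
    unfolding ext_superset[OF J(1) J(2) J(5)] ext_superset[OF J(1) J(3) J(5)] ext_superset[OF J(1) J(4) J(5)] .
qed

lemma ext_zero: "ext 0 = \<zero>" by (simp add: ext_def)

lemma ext_single: "s \<in> K \<Longrightarrow> ext (Poly_Mapping.single s c) = c \<odot> \<phi> s"
  by (subst ext_superset[of "{s}"]) (auto simp: phi_closed scal_closed)

lemma ext_scale:
  assumes "Poly_Mapping.keys a \<subseteq> K"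
  shows "ext (Poly_Mapping.map ((*) c) a) = c \<odot> ext a"
proof -
  have *: "s \<in> K" if "s \<in> Poly_Mapping.keys a" for s using that assms by blast
  show ?thesis
    by (subst ext_superset[OF finite_keys[of a] keys_scale_subset[OF order_refl] assms])
      (auto simp: ext_def scal_finsum * lookup_scale scal_scal phi_closed scal_closed intro!: finsum_cong')
qed

lemma ext_sum:
  assumes "finite I" "\<And>i. i \<in> I \<Longrightarrow> Poly_Mapping.keys (f i) \<subseteq> K"
  shows "ext (\<Sum>i\<in>I. f i) = (\<Oplus>i\<in>I. ext (f i))"
  using assms
proof (induct I)
  case (insert i I)
  then show ?case
    using keys_sum_subset[of I f K] by (simp add: ext_add ext_closed)
qed (simp add: ext_zero)

text \<open>Once both sides are expanded bilinearly, only the multiplicativity of \<open>\<phi>\<close> on basis elements is left.\<close>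

lemma ext_conv:
  assumes a: "Poly_Mapping.keys a \<subseteq> K" and b: "Poly_Mapping.keys b \<subseteq> K"
    and op: "\<And>s t. s \<in> K \<Longrightarrow> t \<in> K \<Longrightarrow> op s t \<in> K"
    and mult: "\<And>s t. s \<in> K \<Longrightarrow> t \<in> K \<Longrightarrow> \<phi> (op s t) = \<phi> s \<otimes> \<phi> t"
  shows "ext (conv op a b) = ext a \<otimes> ext b"
proof -
  let ?a = "Poly_Mapping.lookup a" and ?b = "Poly_Mapping.lookup b"
  have aK: "s \<in> K" if "s \<in> Poly_Mapping.keys a" for s using that a by blast
  have bK: "t \<in> K" if "t \<in> Poly_Mapping.keys b" for t using that b by blast
  note closed = aK bK phi_closed scal_closed prod_closed
  let ?m = "\<lambda>s t. Poly_Mapping.single (op s t) (?a s * ?b t)"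
  have m: "Poly_Mapping.keys (?m s t) \<subseteq> K"
    if "s \<in> Poly_Mapping.keys a" "t \<in> Poly_Mapping.keys b" for s t
    by (intro keys_single_subset op aK bK that)
  have "ext (conv op a b) = (\<Oplus>s\<in>Poly_Mapping.keys a. ext (\<Sum>t\<in>Poly_Mapping.keys b. ?m s t))"
    unfolding conv_def by (intro ext_sum finite_keys keys_sum_subset m)
  also have "\<dots> = (\<Oplus>s\<in>Poly_Mapping.keys a. \<Oplus>t\<in>Poly_Mapping.keys b. ext (?m s t))"
    by (intro finsum_cong' refl ext_sum finite_keys m funcsetI finsum_closed ext_closed)
  also have "\<dots> = (\<Oplus>s\<in>Poly_Mapping.keys a. \<Oplus>t\<in>Poly_Mapping.keys b. (?a s \<odot> \<phi> s) \<otimes> (?b t \<odot> \<phi> t))"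
    by (intro finsum_cong' refl)
      (auto simp: closed ext_single op mult scal_prod_left scal_prod_right scal_scal mult.commute)
  also have "\<dots> = (\<Oplus>s\<in>Poly_Mapping.keys a. (?a s \<odot> \<phi> s) \<otimes> ext b)"
    by (intro finsum_cong' refl) (auto simp: closed ext_def finsum_prod_right)
  also have "\<dots> = ext a \<otimes> ext b"
    unfolding ext_def[of a] by (subst finsum_prod_left) (auto simp: closed ext_closed[OF b])
  finally show ?thesis .
qed

lemma ext_hom:
  assumes "\<And>s t. s \<in> K \<Longrightarrow> t \<in> K \<Longrightarrow> op s t \<in> K"
    and "\<And>s t. s \<in> K \<Longrightarrow> t \<in> K \<Longrightarrow> \<phi> (op s t) = \<phi> s \<otimes> \<phi> t"
  shows "ext \<in> nonassoc_hom (magma_algebra K op e) B"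
  using assms unfolding nonassoc_hom_def by (auto simp: ext_closed ext_add ext_conv ext_scale)

end

primrec magma_fold :: "('b \<Rightarrow> 'b \<Rightarrow> 'b) \<Rightarrow> ('x \<Rightarrow> 'b) \<Rightarrow> 'x magma \<Rightarrow> 'b" where
  "magma_fold m g (Leaf x) = g x"
| "magma_fold m g (Prod s t) = m (magma_fold m g s) (magma_fold m g t)"

text \<open>A tree is sent to the product in \<open>B\<close> that it describes; this is multiplicative by construction.\<close>

lemma free_nonassoc_hom:
  fixes g :: "'x \<Rightarrow> 'b"
  assumes B: "nonassoc_algebra (B :: ('k::field, 'b) module)" and g: "\<And>x. x \<in> X \<Longrightarrow> g x \<in> carrier B"
  obtains f where "f \<in> nonassoc_hom (free_nonassoc X) B"
    "\<And>x. x \<in> X \<Longrightarrow> f (Poly_Mapping.single (Leaf x) 1) = g x"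
proof -
  interpret B: nonassoc_algebra B by fact
  define \<phi> where "\<phi> = magma_fold (mult B) g"
  have closed: "\<phi> t \<in> carrier B" if "leaves t \<subseteq> X" for t
    using that by (induct t) (auto simp: \<phi>_def g B.prod_closed)
  interpret linear_extension B "{t. leaves t \<subseteq> X}" \<phi>
    by unfold_locales (use closed in auto)
  have "ext \<in> nonassoc_hom (free_nonassoc X) B"
    unfolding free_nonassoc_eq by (rule ext_hom) (auto simp: \<phi>_def)
  moreover have "ext (Poly_Mapping.single (Leaf x) 1) = g x" if "x \<in> X" for x
    using that by (simp add: ext_single) (simp add: \<phi>_def B.scal_one g)
  ultimately show thesis using that by blast
qed

text \<open>A word is sent to the product of its letters, which respects concatenation because \<open>B\<close> is
  associative and unital.\<close>

lemma free_assoc_hom: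
  fixes g :: "'x \<Rightarrow> 'b"
  assumes B: "assoc_algebra (B :: ('k::field, 'b) module)" and g: "\<And>x. x \<in> X \<Longrightarrow> g x \<in> carrier B"
  obtains f where "f \<in> nonassoc_hom (free_assoc X) B" "f \<one>\<^bsub>free_assoc X\<^esub> = \<one>\<^bsub>B\<^esub>"
    "\<And>x. x \<in> X \<Longrightarrow> f (assoc_var x) = g x"
proof -
  interpret B: assoc_algebra B by fact
  define \<phi> where "\<phi> xs = foldr (mult B) (map g xs) \<one>\<^bsub>B\<^esub>" for xs
  have closed: "\<phi> xs \<in> carrier B" if "set xs \<subseteq> X" for xs
    using that by (induct xs) (auto simp: \<phi>_def g)
  have app: "\<phi> (xs @ ys) = \<phi> xs \<otimes>\<^bsub>B\<^esub> \<phi> ys" if "set xs \<subseteq> X" "set ys \<subseteq> X" for xs ys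
    using that(1)
  proof (induct xs)
    case Nil
    then show ?case using closed[OF that(2)] by (simp add: \<phi>_def)
  next
    case (Cons x xs)
    then show ?case
      using closed[of xs] closed[OF that(2)] g[of x] by (simp add: \<phi>_def B.m_assoc)
  qed
  interpret linear_extension B "lists X" \<phi>
    by unfold_locales (use closed in \<open>auto simp: in_lists_conv_set subset_iff\<close>)
  have "ext \<in> nonassoc_hom (free_assoc X) B"
    unfolding free_assoc_eq by (rule ext_hom) (use app in \<open>auto simp: in_lists_conv_set subset_iff\<close>)
  moreover have "ext (assoc_var x) = g x" if "x \<in> X" for x
    using that by (simp add: ext_single assoc_var_def) (simp add: \<phi>_def B.scal_one g)
  moreover have "ext \<one>\<^bsub>free_assoc X\<^esub> = \<one>\<^bsub>B\<^esub>"
    by (simp add: free_assoc_eq ext_single) (simp add: \<phi>_def B.scal_one)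
  ultimately show thesis using that by blast
qed

section \<open>Commutators\<close>

text \<open>The Lie algebra of an associative algebra. Homomorphisms of Lie algebras into it are elements of
  \<open>nonassoc_hom L (commutator_algebra A)\<close>.\<close>

definition commutator_algebra :: "('k, 'a) module \<Rightarrow> ('k, 'a) module" where
  "commutator_algebra A = A\<lparr>mult := commutator A\<rparr>"

lemma commutator_algebra_simps [simp]:
  "carrier (commutator_algebra A) = carrier A"
  "mult (commutator_algebra A) = commutator A"
  "zero (commutator_algebra A) = zero A"
  "add (commutator_algebra A) = add A"
  "smult (commutator_algebra A) = smult A"
  by (simp_all add: commutator_algebra_def)

lemma finsum_commutator_algebra: "finsum (commutator_algebra A) = finsum A"
  by (intro ext) (simp add: finsum_def finprod_def commutator_algebra_def)

lemma hom_commutator: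
  assumes A: "nonassoc_algebra A" and B: "nonassoc_algebra B" and f: "f \<in> nonassoc_hom A B"
    and xy: "x \<in> carrier A" "y \<in> carrier A"
  shows "f (commutator A x y) = commutator B (f x) (f y)"
proof -
  interpret A: nonassoc_algebra A by fact
  interpret f: abelian_group_hom A B f by (rule nonassoc_hom_abelian_group_hom[OF A B f])
  show ?thesis unfolding commutator_def using xy
    by (simp add: f.hom_minus A.prod_closed nonassoc_homD(2)[OF f])
qed

context assoc_algebra
begin

abbreviation bracket where "bracket \<equiv> commutator A"

lemma bracket_closed: "x \<in> carrier A \<Longrightarrow> y \<in> carrier A \<Longrightarrow> bracket x y \<in> carrier A"
  by (simp add: commutator_def)

lemma bracket_self: "x \<in> carrier A \<Longrightarrow> bracket x x = \<zero>"
  by (simp add: commutator_def a_minus_def r_neg)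

lemma bracket_swap: "x \<in> carrier A \<Longrightarrow> y \<in> carrier A \<Longrightarrow> bracket x y = \<ominus> bracket y x"
  by (simp add: commutator_def a_minus_def minus_add a_comm)

lemma bracket_jacobi:
  assumes "x \<in> carrier A" "y \<in> carrier A" "z \<in> carrier A"
  shows "bracket x (bracket y z) \<oplus> bracket y (bracket z x) \<oplus> bracket z (bracket x y) = \<zero>"
proof -
  let ?s = "x \<otimes> (y \<otimes> z) \<oplus> x \<otimes> (z \<otimes> y) \<oplus> y \<otimes> (x \<otimes> z) \<oplus> y \<otimes> (z \<otimes> x) \<oplus> z \<otimes> (x \<otimes> y) \<oplus> z \<otimes> (y \<otimes> x)"
  have "bracket x (bracket y z) \<oplus> bracket y (bracket z x) \<oplus> bracket z (bracket x y) = ?s \<oplus> \<ominus> ?s"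
    using assms by (simp add: commutator_def ring_simprules del: r_neg)
  also have "\<dots> = \<zero>" by (rule r_neg) (use assms in simp)
  finally show ?thesis .
qed

lemma bracket_prod_left:
  assumes "x \<in> carrier A" "y \<in> carrier A" "z \<in> carrier A"
  shows "bracket (x \<otimes> y) z = x \<otimes> bracket y z \<oplus> bracket x z \<otimes> y"
  using assms by (simp add: commutator_def ring_simprules r_neg2 r_neg1)

lemma bracket_algebra: "nonassoc_algebra (commutator_algebra A)"
proof (intro nonassoc_algebra.intro nonassoc_algebra_axioms.intro)
  show "abelian_group (commutator_algebra A)"
    by (rule abelian_groupI) (auto simp: a_ac intro: l_neg)
  note minus = abelian_group_hom.hom_minus[OF scal_hom]
  show "(c \<odot>\<^bsub>commutator_algebra A\<^esub> x) \<otimes>\<^bsub>commutator_algebra A\<^esub> y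
      = c \<odot>\<^bsub>commutator_algebra A\<^esub> (x \<otimes>\<^bsub>commutator_algebra A\<^esub> y)"
    if "x \<in> carrier (commutator_algebra A)" "y \<in> carrier (commutator_algebra A)" for c x y
    using that by (simp add: commutator_def scal_prod_left scal_prod_right minus)
  show "x \<otimes>\<^bsub>commutator_algebra A\<^esub> (c \<odot>\<^bsub>commutator_algebra A\<^esub> y)
      = c \<odot>\<^bsub>commutator_algebra A\<^esub> (x \<otimes>\<^bsub>commutator_algebra A\<^esub> y)"
    if "x \<in> carrier (commutator_algebra A)" "y \<in> carrier (commutator_algebra A)" for c x y
    using that by (simp add: commutator_def scal_prod_left scal_prod_right minus)
qed (simp_all add: bracket_closed scal_closed scal_add_right scal_add_left scal_scal scal_one,
    simp_all add: commutator_def ring_simprules)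

lemmas bracket_linear =
  nonassoc_algebra.prod_add_left[OF bracket_algebra, simplified]
  nonassoc_algebra.prod_add_right[OF bracket_algebra, simplified]
  nonassoc_algebra.scal_prod_left[OF bracket_algebra, simplified]
  nonassoc_algebra.scal_prod_right[OF bracket_algebra, simplified]
  nonassoc_algebra.prod_zero_left[OF bracket_algebra, simplified]
  nonassoc_algebra.prod_zero_right[OF bracket_algebra, simplified]

lemma bracket_finsum_left:
  assumes "\<And>i. i \<in> I \<Longrightarrow> g i \<in> carrier A" "y \<in> carrier A"
  shows "bracket (\<Oplus>i\<in>I. g i) y = (\<Oplus>i\<in>I. bracket (g i) y)"
  using nonassoc_algebra.finsum_prod_left[OF bracket_algebra, of I g y] assms
  by (simp add: finsum_commutator_algebra)

lemma bracket_finsum_right: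
  assumes "\<And>i. i \<in> I \<Longrightarrow> g i \<in> carrier A" "y \<in> carrier A"
  shows "bracket y (\<Oplus>i\<in>I. g i) = (\<Oplus>i\<in>I. bracket y (g i))"
  using nonassoc_algebra.finsum_prod_right[OF bracket_algebra, of I g y] assms
  by (simp add: finsum_commutator_algebra)

end

section \<open>Universal properties\<close>

lemma assoc_var_closed: "x \<in> X \<Longrightarrow> assoc_var x \<in> carrier (free_assoc X)"
  by (simp add: assoc_var_def free_assoc_eq)

lemma lie_axioms_closed:
  assumes "nonassoc_algebra A"
  shows "lie_axioms A \<subseteq> carrier A"
proof -
  interpret nonassoc_algebra A by fact
  show ?thesis by (auto simp: lie_axioms_def prod_closed)
qed

lemma free_lie_quotient: "algebra_quotient (free_nonassoc X) (lie_axioms (free_nonassoc X))"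
  by (intro algebra_quotient.intro algebra_quotient_axioms.intro free_nonassoc_algebra lie_axioms_closed)

lemma free_lie_algebra: "nonassoc_algebra (free_lie X)"
  unfolding free_lie_def by (rule algebra_quotient.quotient_algebra[OF free_lie_quotient])

lemma lie_var_closed: "x \<in> X \<Longrightarrow> lie_var X x \<in> carrier (free_lie X)"
  unfolding lie_var_def free_lie_def algebra_quotient.quot_carrier[OF free_lie_quotient]
  by (intro imageI) (simp add: free_nonassoc_eq)

text \<open>The relations of the free Lie algebra die in \<open>A\<close> because its commutator is alternating and
  satisfies the Jacobi identity.\<close>

lemma free_lie_hom:
  fixes g :: "'x \<Rightarrow> 'b"
  assumes A: "assoc_algebra (A :: ('k::field, 'b) module)" and g: "\<And>x. x \<in> X \<Longrightarrow> g x \<in> carrier A"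
  obtains f where "f \<in> nonassoc_hom (free_lie X) (commutator_algebra A)"
    "\<And>x. x \<in> X \<Longrightarrow> f (lie_var X x) = g x"
proof -
  interpret A: assoc_algebra A by fact
  interpret M: algebra_quotient "free_nonassoc X :: ('k, _) module" "lie_axioms (free_nonassoc X)"
    by (rule free_lie_quotient)
  obtain f where f: "f \<in> nonassoc_hom (free_nonassoc X) (commutator_algebra A)"
    "\<And>x. x \<in> X \<Longrightarrow> f (Poly_Mapping.single (Leaf x) 1) = g x"
    using free_nonassoc_hom[OF A.bracket_algebra, of X g] g by auto
  note h = nonassoc_homD[OF f(1), simplified]
  have "f z = \<zero>\<^bsub>commutator_algebra A\<^esub>" if "z \<in> lie_axioms (free_nonassoc X)" for z
    using that unfolding lie_axioms_def
    by (auto simp: h M.prod_closed A.bracket_self A.bracket_jacobi)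
  then obtain f' where f': "f' \<in> nonassoc_hom (free_lie X) (commutator_algebra A)"
    "\<And>x. x \<in> carrier (free_nonassoc X) \<Longrightarrow>
      f' (class_by (free_nonassoc X) (lie_axioms (free_nonassoc X)) x) = f x"
    using M.lift[OF A.bracket_algebra f(1)] unfolding free_lie_def by blast
  have "f' (lie_var X x) = g x" if "x \<in> X" for x
    using that f(2)[OF that] unfolding lie_var_def by (subst f'(2)) (auto simp: free_nonassoc_eq)
  with f'(1) show thesis using that by blast
qed

lemma lie_yang_mills_quotient: "algebra_quotient (free_lie {1..n}) (ym_relations n)"
proof (intro algebra_quotient.intro algebra_quotient_axioms.intro free_lie_algebra)
  interpret L: nonassoc_algebra "free_lie {1..n} :: ('k::field, _) module" by (rule free_lie_algebra)
  show "ym_relations n \<subseteq> carrier (free_lie {1..n} :: ('k::field, _) module)"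
    by (auto simp: ym_relations_def Let_def simp del: One_nat_def
        intro!: L.finsum_closed L.prod_closed lie_var_closed)
qed

lemma lie_yang_mills_algebra: "nonassoc_algebra (lie_yang_mills n)"
  unfolding lie_yang_mills_def by (rule algebra_quotient.quotient_algebra[OF lie_yang_mills_quotient])

definition lie_ym_var :: "nat \<Rightarrow> nat \<Rightarrow> 'k::field ym_elem" where
  "lie_ym_var n i = class_by (free_lie {1..n}) (ym_relations n) (lie_var {1..n} i)"

lemma lie_ym_var_closed: "i \<in> {1..n} \<Longrightarrow> lie_ym_var n i \<in> carrier (lie_yang_mills n)"
  unfolding lie_ym_var_def lie_yang_mills_def algebra_quotient.quot_carrier[OF lie_yang_mills_quotient]
  by (intro imageI lie_var_closed)

text \<open>A homomorphism from the free Lie algebra turns the relations into the sums of iterated commutators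
  in \<open>ym\<close>, so the hypothesis is exactly what makes it factor.\<close>

lemma lie_yang_mills_hom:
  fixes a :: "nat \<Rightarrow> 'b"
  assumes A: "assoc_algebra (A :: ('k::field, 'b) module)"
    and a: "\<And>i. i \<in> {1..n} \<Longrightarrow> a i \<in> carrier A"
    and ym: "\<And>j. j \<in> {1..n} \<Longrightarrow>
      (\<Oplus>\<^bsub>A\<^esub>i\<in>{1..n}. commutator A (a i) (commutator A (a i) (a j))) = \<zero>\<^bsub>A\<^esub>"
  obtains f where "f \<in> nonassoc_hom (lie_yang_mills n) (commutator_algebra A)"
    "\<And>i. i \<in> {1..n} \<Longrightarrow> f (lie_ym_var n i) = a i"
proof -
  interpret A: assoc_algebra A by fact
  interpret L: algebra_quotient "free_lie {1..n} :: ('k, _) module" "ym_relations n"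
    by (rule lie_yang_mills_quotient)
  obtain f where f: "f \<in> nonassoc_hom (free_lie {1..n}) (commutator_algebra A)"
    "\<And>i. i \<in> {1..n} \<Longrightarrow> f (lie_var {1..n} i) = a i"
    using free_lie_hom[OF A, of "{1..n}" a] a by blast
  interpret f: abelian_group_hom "free_lie {1..n}" "commutator_algebra A" f
    by (rule nonassoc_hom_abelian_group_hom[OF L.nonassoc_algebra_axioms A.bracket_algebra f(1)])
  have "f z = \<zero>\<^bsub>commutator_algebra A\<^esub>" if z: "z \<in> ym_relations n" for z
  proof -
    let ?x = "lie_var {1..n}"
    obtain j where j: "j \<in> {1..n}" and zj: "z = (\<Oplus>\<^bsub>free_lie {1..n}\<^esub>i\<in>{1..n}.
        ?x i \<otimes>\<^bsub>free_lie {1..n}\<^esub> (?x i \<otimes>\<^bsub>free_lie {1..n}\<^esub> ?x j))"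
      using z unfolding ym_relations_def Let_def by blast
    have f_term: "f (?x i \<otimes>\<^bsub>free_lie {1..n}\<^esub> (?x i \<otimes>\<^bsub>free_lie {1..n}\<^esub> ?x j))
        = commutator A (a i) (commutator A (a i) (a j))" if i: "i \<in> {1..n}" for i
      using nonassoc_homD(2)[OF f(1) lie_var_closed[OF i] L.prod_closed[OF lie_var_closed[OF i] lie_var_closed[OF j]]]
        nonassoc_homD(2)[OF f(1) lie_var_closed[OF i] lie_var_closed[OF j]] f(2)[OF i] f(2)[OF j]
      by (simp only: commutator_algebra_simps)
    have "f z = (\<Oplus>\<^bsub>A\<^esub>i\<in>{1..n}. f (?x i \<otimes>\<^bsub>free_lie {1..n}\<^esub> (?x i \<otimes>\<^bsub>free_lie {1..n}\<^esub> ?x j)))"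
      unfolding zj finsum_commutator_algebra[of A, symmetric] by (intro f.hom_finsum L.prod_closed lie_var_closed j)
    also have "\<dots> = (\<Oplus>\<^bsub>A\<^esub>i\<in>{1..n}. commutator A (a i) (commutator A (a i) (a j)))"
      by (intro A.finsum_cong' refl funcsetI A.bracket_closed a j f_term)
    finally show ?thesis using ym[OF j] by simp
  qed
  then obtain f' where f': "f' \<in> nonassoc_hom (lie_yang_mills n) (commutator_algebra A)"
    "\<And>x. x \<in> carrier (free_lie {1..n}) \<Longrightarrow> f' (class_by (free_lie {1..n}) (ym_relations n) x) = f x"
    using L.lift[OF A.bracket_algebra f(1)] unfolding lie_yang_mills_def by blast
  have "f' (lie_ym_var n i) = a i" if "i \<in> {1..n}" for i
    unfolding lie_ym_var_def f'(2)[OF lie_var_closed[OF that]] by (rule f(2)[OF that])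
  with f'(1) show thesis using that by blast
qed

context
  fixes L :: "('k::field, 'a) module"
  assumes L: "nonassoc_algebra L"
begin

interpretation L: nonassoc_algebra L by (rule L)

interpretation F: assoc_algebra "free_assoc (carrier L) :: ('k, 'a list \<Rightarrow>\<^sub>0 'k) module"
  by (rule free_assoc_algebra)

lemma tensor_relations_closed: "tensor_relations L \<subseteq> carrier (free_assoc (carrier L))"
  unfolding tensor_relations_def Let_def
  by (auto intro!: F.minus_closed F.a_closed F.scal_closed assoc_var_closed L.scal_closed L.a_closed)

interpretation T: algebra_quotient "free_assoc (carrier L) :: ('k, 'a list \<Rightarrow>\<^sub>0 'k) module" "tensor_relations L"
  by unfold_locales (rule tensor_relations_closed)

lemma tensor_algebra: "assoc_algebra (tensor_alg L)"
  unfolding tensor_alg_def by (rule quotient_assoc_algebra[OF F.assoc_algebra_axioms tensor_relations_closed])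

interpretation TL: assoc_algebra "tensor_alg L" by (rule tensor_algebra)

lemma tensor_var_closed: "x \<in> carrier L \<Longrightarrow> tensor_var L x \<in> carrier (tensor_alg L)"
  unfolding tensor_var_def tensor_alg_def T.quot_carrier by (intro imageI assoc_var_closed)

lemma env_relations_closed: "env_relations L \<subseteq> carrier (tensor_alg L)"
  unfolding env_relations_def Let_def
  by (auto intro!: TL.minus_closed TL.bracket_closed tensor_var_closed L.prod_closed)

interpretation U: algebra_quotient "tensor_alg L" "env_relations L"
  by unfold_locales (rule env_relations_closed)

lemma univ_env_algebra: "assoc_algebra (univ_env L)"
  unfolding univ_env_def by (rule quotient_assoc_algebra[OF tensor_algebra env_relations_closed])

definition env_var :: "'a \<Rightarrow> ('a list \<Rightarrow>\<^sub>0 'k) set set" where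
  "env_var x = class_by (tensor_alg L) (env_relations L) (tensor_var L x)"

lemma env_var_closed: "x \<in> carrier L \<Longrightarrow> env_var x \<in> carrier (univ_env L)"
  unfolding env_var_def univ_env_def U.quot_carrier by (intro imageI tensor_var_closed)

text \<open>The map on words induced by \<open>g\<close> factors through the tensor algebra because \<open>g\<close> is linear, and then
  through the enveloping algebra because \<open>g\<close> turns brackets into commutators.\<close>

lemma univ_env_hom:
  assumes A: "assoc_algebra (A :: ('k, 'b) module)"
    and g: "g \<in> nonassoc_hom L (commutator_algebra A)"
  obtains f where "f \<in> nonassoc_hom (univ_env L) A" "f \<one>\<^bsub>univ_env L\<^esub> = \<one>\<^bsub>A\<^esub>"
    "\<And>x. x \<in> carrier L \<Longrightarrow> f (env_var x) = g x"
proof -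
  interpret A: assoc_algebra A by fact
  note gh = nonassoc_homD[OF g, simplified]
  let ?F = "free_assoc (carrier L) :: ('k, 'a list \<Rightarrow>\<^sub>0 'k) module"
  obtain f0 where f0: "f0 \<in> nonassoc_hom ?F A" "f0 \<one>\<^bsub>?F\<^esub> = \<one>\<^bsub>A\<^esub>"
    "\<And>x. x \<in> carrier L \<Longrightarrow> f0 (assoc_var x) = g x"
    using free_assoc_hom[OF A, of "carrier L" g] gh(1) by blast
  interpret f0: abelian_group_hom ?F A f0
    by (rule nonassoc_hom_abelian_group_hom[OF F.nonassoc_algebra_axioms A.nonassoc_algebra_axioms f0(1)])
  note closed = assoc_var_closed L.a_closed L.scal_closed L.prod_closed F.a_closed F.scal_closed
  have "f0 z = \<zero>\<^bsub>A\<^esub>" if "z \<in> tensor_relations L" for z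
    using that unfolding tensor_relations_def Let_def
    by (auto simp: closed f0.hom_minus nonassoc_homD[OF f0(1)] f0(3) gh A.r_neg a_minus_def A.scal_closed
        simp del: A.minus_add)
  then obtain f1 where f1: "f1 \<in> nonassoc_hom (tensor_alg L) A"
    "\<And>x. x \<in> carrier ?F \<Longrightarrow> f1 (class_by ?F (tensor_relations L) x) = f0 x"
    using T.lift[OF A.nonassoc_algebra_axioms f0(1)] unfolding tensor_alg_def by blast
  have f1_var: "f1 (tensor_var L x) = g x" if "x \<in> carrier L" for x
    unfolding tensor_var_def f1(2)[OF assoc_var_closed[OF that]] by (rule f0(3)[OF that])
  have f1_one: "f1 \<one>\<^bsub>tensor_alg L\<^esub> = \<one>\<^bsub>A\<^esub>"
    unfolding tensor_alg_def T.quot_one f1(2)[OF F.one_closed] by (rule f0(2))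
  interpret f1: abelian_group_hom "tensor_alg L" A f1
    by (rule nonassoc_hom_abelian_group_hom[OF TL.nonassoc_algebra_axioms A.nonassoc_algebra_axioms f1(1)])
  have "f1 z = \<zero>\<^bsub>A\<^esub>" if z: "z \<in> env_relations L" for z
  proof -
    obtain x y where xy: "x \<in> carrier L" "y \<in> carrier L"
      and zxy: "z = commutator (tensor_alg L) (tensor_var L x) (tensor_var L y)
        \<ominus>\<^bsub>tensor_alg L\<^esub> tensor_var L (x \<otimes>\<^bsub>L\<^esub> y)"
      using z unfolding env_relations_def Let_def by blast
    have "f1 z = commutator A (g x) (g y) \<ominus>\<^bsub>A\<^esub> g (x \<otimes>\<^bsub>L\<^esub> y)"
      unfolding zxy using xy
      by (simp add: f1.hom_minus TL.bracket_closed tensor_var_closed L.prod_closed f1_var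
          hom_commutator[OF TL.nonassoc_algebra_axioms A.nonassoc_algebra_axioms f1(1)])
    then show ?thesis using xy by (simp add: gh a_minus_def A.r_neg A.bracket_closed)
  qed
  then obtain f2 where f2: "f2 \<in> nonassoc_hom (univ_env L) A"
    "\<And>x. x \<in> carrier (tensor_alg L) \<Longrightarrow> f2 (class_by (tensor_alg L) (env_relations L) x) = f1 x"
    using U.lift[OF A.nonassoc_algebra_axioms f1(1)] unfolding univ_env_def by blast
  have "f2 (env_var x) = g x" if "x \<in> carrier L" for x
    unfolding env_var_def f2(2)[OF tensor_var_closed[OF that]] by (rule f1_var[OF that])
  moreover have "f2 \<one>\<^bsub>univ_env L\<^esub> = \<one>\<^bsub>A\<^esub>"
    unfolding univ_env_def U.quot_one f2(2)[OF TL.one_closed] by (rule f1_one)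
  ultimately show thesis using f2(1) that by blast
qed

end

section \<open>Subalgebras and eigenvectors\<close>

definition unital_subalgebra :: "'a set \<Rightarrow> ('k, 'a) module \<Rightarrow> bool" where
  "unital_subalgebra R A \<longleftrightarrow> R \<subseteq> carrier A \<and> \<one>\<^bsub>A\<^esub> \<in> R \<and>
     (\<forall>x\<in>R. \<forall>y\<in>R. x \<oplus>\<^bsub>A\<^esub> y \<in> R \<and> x \<otimes>\<^bsub>A\<^esub> y \<in> R) \<and> (\<forall>c. \<forall>x\<in>R. c \<odot>\<^bsub>A\<^esub> x \<in> R)"

lemma unital_subalgebraD:
  assumes "unital_subalgebra R A"
  shows "x \<in> R \<Longrightarrow> x \<in> carrier A" "\<one>\<^bsub>A\<^esub> \<in> R"
    "x \<in> R \<Longrightarrow> y \<in> R \<Longrightarrow> x \<oplus>\<^bsub>A\<^esub> y \<in> R" "x \<in> R \<Longrightarrow> y \<in> R \<Longrightarrow> x \<otimes>\<^bsub>A\<^esub> y \<in> R"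
    "x \<in> R \<Longrightarrow> c \<odot>\<^bsub>A\<^esub> x \<in> R"
  using assms by (auto simp: unital_subalgebra_def)

lemma hom_image_subalgebra:
  assumes A: "assoc_algebra A" and f: "f \<in> nonassoc_hom A B" "f \<one>\<^bsub>A\<^esub> = \<one>\<^bsub>B\<^esub>"
  shows "unital_subalgebra (f ` carrier A) B"
proof -
  interpret A: assoc_algebra A by fact
  note h = nonassoc_homD[OF f(1)]
  have "f x \<oplus>\<^bsub>B\<^esub> f y \<in> f ` carrier A" "f x \<otimes>\<^bsub>B\<^esub> f y \<in> f ` carrier A"
    if "x \<in> carrier A" "y \<in> carrier A" for x y
    unfolding h(2,3)[OF that, symmetric] using that by auto
  moreover have "c \<odot>\<^bsub>B\<^esub> f x \<in> f ` carrier A" if "x \<in> carrier A" for c x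
    unfolding h(4)[OF that, symmetric] using that A.scal_closed by auto
  moreover have "\<one>\<^bsub>B\<^esub> \<in> f ` carrier A" unfolding f(2)[symmetric] by simp
  ultimately show ?thesis unfolding unital_subalgebra_def using h(1) by auto
qed

lemma hom_preimage_subalgebra:
  assumes A: "assoc_algebra A" and f: "f \<in> nonassoc_hom A B" "f \<one>\<^bsub>A\<^esub> = \<one>\<^bsub>B\<^esub>"
    and R: "unital_subalgebra R B"
  shows "unital_subalgebra {x \<in> carrier A. f x \<in> R} A"
proof -
  interpret A: assoc_algebra A by fact
  show ?thesis
    using unital_subalgebraD[OF R]
    by (auto simp: unital_subalgebra_def nonassoc_homD[OF f(1)] f(2) A.scal_closed)
qed

text \<open>By induction on their length all words lie in \<open>R\<close>, and every element is a combination of words.\<close>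

lemma free_assoc_generated:
  assumes R: "unital_subalgebra R (free_assoc X :: ('k::field, 'x list \<Rightarrow>\<^sub>0 'k) module)"
    and var: "\<And>x. x \<in> X \<Longrightarrow> assoc_var x \<in> R"
  shows "R = carrier (free_assoc X)"
proof
  show "R \<subseteq> carrier (free_assoc X)" using R by (simp add: unital_subalgebra_def)
  note closed = unital_subalgebraD(2-5)[OF R, unfolded free_assoc_eq magma_algebra_simps]
  have word: "Poly_Mapping.single s 1 \<in> R" if "s \<in> lists X" for s
    using that
  proof (induct s)
    case (Cons x s)
    then show ?case using closed(3)[OF var[of x], of "Poly_Mapping.single s 1"] by (simp add: assoc_var_def)
  qed (rule closed(1))
  have zero: "0 \<in> R" using closed(4)[OF closed(1), of 0] by simp
  have "(\<Sum>s\<in>J. Poly_Mapping.single s (c s)) \<in> R" if "finite J" "J \<subseteq> lists X" for J and c :: "'x list \<Rightarrow> 'k"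
    using that
  proof (induct J)
    case (insert s J)
    then show ?case using closed(2) closed(4)[OF word[of s], of "c s"] by simp
  qed (simp add: zero)
  then have "a \<in> R" if "Poly_Mapping.keys a \<subseteq> lists X" for a
    using sum_singles[OF finite_keys order_refl, of a] that finite_keys[of a] by metis
  then show "carrier (free_assoc X) \<subseteq> R" by (auto simp: free_assoc_eq)
qed

context assoc_algebra
begin

lemma subalgebra_minus:
  assumes "unital_subalgebra R A" "x \<in> R" "y \<in> R"
  shows "x \<ominus> y \<in> R"
  using unital_subalgebraD[OF assms(1)] assms(2,3) by (simp add: minus_as_scal)

lemma subalgebra_bracket:
  assumes "unital_subalgebra R A" "x \<in> R" "y \<in> R"
  shows "bracket x y \<in> R"
  using unital_subalgebraD(4)[OF assms(1)] assms subalgebra_minus by (simp add: commutator_def)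

lemma subalgebra_finsum:
  assumes R: "unital_subalgebra R A" and g: "\<And>i. i \<in> I \<Longrightarrow> g i \<in> R"
  shows "(\<Oplus>i\<in>I. g i) \<in> R"
proof -
  have "\<zero> \<in> R"
    using unital_subalgebraD(5)[OF R unital_subalgebraD(2)[OF R], of 0] by (simp add: scal_zero_left)
  then show ?thesis
    using g by (induct I rule: infinite_finite_induct)
      (auto simp: Pi_def unital_subalgebraD(1,3)[OF R])
qed

text \<open>Applying \<open>ad v - \<mu> k\<close> to a sum of eigenvectors removes the \<open>k\<close>-th one and rescales the others by the
  nonzero factors \<open>\<mu> i - \<mu> k\<close>. By induction on the number of eigenvectors the others are in \<open>R\<close>, and then
  so is the \<open>k\<close>-th.\<close>

lemma eigencomponents_in_subalgebra:
  assumes R: "unital_subalgebra R A" and v: "v \<in> R" and J: "finite J"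
    and e: "\<And>i. i \<in> J \<Longrightarrow> e i \<in> carrier A"
    and eigen: "\<And>i. i \<in> J \<Longrightarrow> bracket v (e i) = \<mu> i \<odot> e i"
    and inj: "inj_on \<mu> J"
    and sum: "(\<Oplus>i\<in>J. e i) \<in> R" and i: "i \<in> J"
  shows "e i \<in> R"
  using J e eigen inj sum i
proof (induct J arbitrary: e i)
  case (insert k J)
  note RD = unital_subalgebraD[OF R]
  have ek: "e k \<in> carrier A" and eJ: "\<And>i. i \<in> J \<Longrightarrow> e i \<in> carrier A" using insert.prems(1) by auto
  have vc: "v \<in> carrier A" using RD(1) v .
  let ?s = "\<Oplus>i\<in>J. e i"
  have s: "?s \<in> carrier A" using eJ by (intro finsum_closed) auto
  have total: "e k \<oplus> ?s \<in> R" using insert.hyps insert.prems(4) ek eJ by (simp add: Pi_def)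
  define e' where "e' i = (\<mu> i - \<mu> k) \<odot> e i" for i
  have e': "e' i \<in> carrier A" if "i \<in> J" for i using eJ[OF that] by (simp add: e'_def scal_closed)
  have "bracket v ?s = (\<Oplus>i\<in>J. \<mu> i \<odot> e i)"
    using insert.prems(2) eJ vc
    by (subst bracket_finsum_right) (auto intro!: finsum_cong' simp: scal_closed)
  also have "\<dots> = (\<Oplus>i\<in>J. e' i \<oplus> \<mu> k \<odot> e i)"
    using eJ by (intro finsum_cong' refl) (auto simp: e'_def scal_closed scal_add_left[symmetric])
  also have "\<dots> = (\<Oplus>i\<in>J. e' i) \<oplus> \<mu> k \<odot> ?s"
    using eJ e' by (subst finsum_addf) (auto simp: scal_finsum scal_closed)
  finally have vs: "bracket v ?s = (\<Oplus>i\<in>J. e' i) \<oplus> \<mu> k \<odot> ?s" .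
  have e's: "(\<Oplus>i\<in>J. e' i) \<in> carrier A" using e' by (intro finsum_closed) auto
  have cancel: "(a \<oplus> (b \<oplus> d)) \<ominus> (a \<oplus> d) = b"
    if "a \<in> carrier A" "b \<in> carrier A" "d \<in> carrier A" for a b d
    using that by algebra
  have "bracket v (e k \<oplus> ?s) \<ominus> \<mu> k \<odot> (e k \<oplus> ?s) = (\<Oplus>i\<in>J. e' i)"
    using insert.prems(2)[of k] ek s vc e's
    by (simp add: bracket_linear vs scal_add_right scal_closed cancel)
  moreover have "bracket v (e k \<oplus> ?s) \<ominus> \<mu> k \<odot> (e k \<oplus> ?s) \<in> R"
    by (intro subalgebra_minus[OF R] subalgebra_bracket[OF R] RD(5) total v)
  ultimately have "(\<Oplus>i\<in>J. e' i) \<in> R" by simp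
  moreover have "bracket v (e' i) = \<mu> i \<odot> e' i" if "i \<in> J" for i
    using insert.prems(2)[of i] that eJ[OF that] vc by (simp add: e'_def bracket_linear scal_scal mult.commute)
  ultimately have e'R: "e' i \<in> R" if "i \<in> J" for i
    using insert.hyps(3)[of e' i] insert.prems(3) e' that by simp
  have eR: "e i \<in> R" if "i \<in> J" for i
  proof -
    have "\<mu> i \<noteq> \<mu> k" using insert.prems(3) insert.hyps(2) that by (auto simp: inj_on_def)
    then have "e i = inverse (\<mu> i - \<mu> k) \<odot> e' i"
      using eJ[OF that] by (simp add: e'_def scal_scal scal_one)
    then show ?thesis using RD(5)[OF e'R[OF that]] by simp
  qed
  have "e k = (e k \<oplus> ?s) \<ominus> ?s" using ek s by (simp add: a_minus_def a_assoc r_neg)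
  also have "\<dots> \<in> R" by (intro subalgebra_minus[OF R] total subalgebra_finsum[OF R] eR)
  finally show ?case using eR insert.prems(5) by auto
qed simp

lemma finsum_scal_left:
  assumes "x \<in> carrier A"
  shows "(\<Oplus>i\<in>I. d i \<odot> x) = (\<Sum>i\<in>I. d i) \<odot> x"
  using assms by (induct I rule: infinite_finite_induct)
    (auto simp: scal_zero_left scal_add_left scal_closed Pi_def)

section \<open>Yang-Mills elements from a null direction\<close>

text \<open>The vector \<open>(1, \<iota>, 0, \<dots>, 0)\<close> is isotropic for the form \<open>\<Sum>\<^sub>i x\<^sub>i\<^sup>2\<close> when \<open>\<iota>\<^sup>2 = -1\<close>, and \<open>v\<close> is placed along it;
  \<open>w\<close> is placed along a vector orthogonal to it.\<close>

definition null_ym_tuple :: "'k \<Rightarrow> 'a \<Rightarrow> 'a \<Rightarrow> nat \<Rightarrow> 'a" where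
  "null_ym_tuple \<iota> v w i = (if i = 1 then v else if i = 2 then \<iota> \<odot> v else if i = 3 then w else \<zero>)"

lemma null_ym_tuple_closed:
  "v \<in> carrier A \<Longrightarrow> w \<in> carrier A \<Longrightarrow> null_ym_tuple \<iota> v w i \<in> carrier A"
  by (simp add: null_ym_tuple_def scal_closed)

text \<open>The first two terms cancel since the second is \<open>\<iota>\<^sup>2\<close> times the first. The third is
  \<open>[w, [w, a\<^sub>j]]\<close>, where \<open>a\<^sub>j\<close> is a multiple of \<open>v\<close> or of \<open>w\<close>.\<close>

lemma null_ym_tuple_relation:
  assumes vw: "v \<in> carrier A" "w \<in> carrier A" and \<iota>: "\<iota> * \<iota> = - 1" and n: "n \<ge> 3"
    and wwv: "bracket w (bracket w v) = \<zero>"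
  defines "a \<equiv> null_ym_tuple \<iota> v w"
  shows "(\<Oplus>i\<in>{1..n}. bracket (a i) (bracket (a i) (a j))) = \<zero>"
proof -
  have a: "a i \<in> carrier A" for i unfolding a_def by (rule null_ym_tuple_closed[OF vw])
  have a_simps: "a 1 = v" "a 2 = \<iota> \<odot> v" "a 3 = w" and a0: "\<And>i. i \<notin> {1, 2, 3} \<Longrightarrow> a i = \<zero>"
    by (simp_all add: a_def null_ym_tuple_def)
  let ?t = "\<lambda>i. bracket (a i) (bracket (a i) (a j))"
  have t: "?t i \<in> carrier A" for i by (intro bracket_closed a)
  have "?t 2 = (\<iota> * \<iota>) \<odot> ?t 1"
    unfolding a_simps using vw(1) a by (simp add: bracket_linear bracket_closed scal_scal scal_closed)
  then have t2: "?t 2 = \<ominus> ?t 1" using t[of 1] by (simp add: \<iota> scal_uminus scal_one)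
  have "a j \<in> {v, \<iota> \<odot> v, w, \<zero>}" by (simp add: a_def null_ym_tuple_def)
  then have t3: "?t 3 = \<zero>"
    unfolding a_simps using vw wwv by (auto simp: bracket_linear bracket_self bracket_closed scal_zero_right)
  \<comment> \<open>All later entries of the tuple are zero.\<close>
  have "(\<Oplus>i\<in>{1..n}. ?t i) = (\<Oplus>i\<in>{1, 2, 3}. ?t i)"
    by (rule add.finprod_mono_neutral_cong_right)
      (use n t a in \<open>auto simp: a0 bracket_linear bracket_closed\<close>)
  also have "\<dots> = ?t 1 \<oplus> (?t 2 \<oplus> ?t 3)" using t by (simp add: Pi_def)
  also have "\<dots> = \<zero>" unfolding t2 t3 using t[of 1] by (simp add: r_neg)
  finally show ?thesis .
qed

end

section \<open>Generating canonical pairs\<close>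

locale canonical_pairs = assoc_algebra A for A :: "('k::field, 'a) module" (structure) +
  fixes I :: "nat set" and p q :: "nat \<Rightarrow> 'a"
  assumes finite_I: "finite I"
    and p_closed: "i \<in> I \<Longrightarrow> p i \<in> carrier A" and q_closed: "i \<in> I \<Longrightarrow> q i \<in> carrier A"
    and pq: "i \<in> I \<Longrightarrow> j \<in> I \<Longrightarrow> commutator A (p i) (q j) = (if i = j then \<one> else \<zero>)"
    and pp: "i \<in> I \<Longrightarrow> j \<in> I \<Longrightarrow> commutator A (p i) (p j) = \<zero>"
    and qq: "i \<in> I \<Longrightarrow> j \<in> I \<Longrightarrow> commutator A (q i) (q j) = \<zero>"
begin

lemma qp: "i \<in> I \<Longrightarrow> j \<in> I \<Longrightarrow> bracket (q i) (p j) = (if i = j then \<ominus> \<one> else \<zero>)"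
  using bracket_swap[OF q_closed p_closed, of i j] by (simp add: pq)

lemma finsum_delta:
  assumes "j \<in> I" "x \<in> carrier A"
  shows "(\<Oplus>i\<in>I. if i = j then x else \<zero>) = x"
  using add.finprod_singleton_swap[OF assms(1) finite_I, of "\<lambda>_. x"] assms(2) by simp

text \<open>The Euler operator with weight \<open>l i\<close> on the \<open>i\<close>-th pair: \<open>q i\<close> acts as a variable and \<open>p i\<close> as its derivative.\<close>

definition euler :: "(nat \<Rightarrow> 'k) \<Rightarrow> 'a" where
  "euler l = (\<Oplus>i\<in>I. l i \<odot> (q i \<otimes> p i))"

definition linear_form :: "(nat \<Rightarrow> 'k) \<Rightarrow> 'a" where
  "linear_form c = (\<Oplus>i\<in>I. q i \<oplus> c i \<odot> p i)"

lemma closed: "euler l \<in> carrier A" "linear_form c \<in> carrier A"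
  by (auto simp: euler_def linear_form_def intro!: finsum_closed scal_closed p_closed q_closed)

lemma euler_q:
  assumes j: "j \<in> I"
  shows "bracket (euler l) (q j) = l j \<odot> q j"
proof -
  have "bracket (euler l) (q j) = (\<Oplus>i\<in>I. if i = j then l j \<odot> q j else \<zero>)"
    unfolding euler_def using j
    by (subst bracket_finsum_left)
      (auto intro!: finsum_cong' simp: scal_closed p_closed q_closed bracket_linear bracket_prod_left pq qq scal_zero_right)
  then show ?thesis using j by (simp add: finsum_delta scal_closed q_closed)
qed

lemma euler_p:
  assumes j: "j \<in> I"
  shows "bracket (euler l) (p j) = (- l j) \<odot> p j"
proof -
  have "bracket (euler l) (p j) = (\<Oplus>i\<in>I. if i = j then (- l j) \<odot> p j else \<zero>)"
    unfolding euler_def using j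
    by (subst bracket_finsum_left)
      (auto intro!: finsum_cong' simp: scal_closed p_closed q_closed bracket_linear bracket_prod_left pp qp
        scal_zero_right l_minus scal_uminus abelian_group_hom.hom_a_inv[OF scal_hom])
  then show ?thesis using j by (simp add: finsum_delta scal_closed p_closed)
qed

lemma linear_form_q:
  assumes j: "j \<in> I"
  shows "bracket (linear_form c) (q j) = c j \<odot> \<one>"
proof -
  have "bracket (linear_form c) (q j) = (\<Oplus>i\<in>I. if i = j then c j \<odot> \<one> else \<zero>)"
    unfolding linear_form_def using j
    by (subst bracket_finsum_left)
      (auto intro!: finsum_cong' simp: scal_closed p_closed q_closed bracket_linear pq qq scal_zero_right)
  then show ?thesis using j by (simp add: finsum_delta scal_closed)
qed

lemma linear_form_p:
  assumes j: "j \<in> I"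
  shows "bracket (linear_form c) (p j) = (- 1) \<odot> \<one>"
proof -
  have "bracket (linear_form c) (p j) = (\<Oplus>i\<in>I. if i = j then \<ominus> \<one> else \<zero>)"
    unfolding linear_form_def using j
    by (subst bracket_finsum_left)
      (auto intro!: finsum_cong' simp: scal_closed p_closed q_closed bracket_linear pp qp scal_zero_right)
  then show ?thesis using j by (simp add: finsum_delta scal_uminus scal_one)
qed

lemma euler_linear_form:
  "bracket (euler l) (linear_form c) = (\<Oplus>i\<in>I. l i \<odot> q i \<oplus> (- (l i * c i)) \<odot> p i)"
  unfolding linear_form_def
  by (subst bracket_finsum_right)
    (auto intro!: finsum_cong' closed simp: scal_closed p_closed q_closed bracket_linear closed
      euler_q euler_p scal_scal mult.commute simp del: finsum_addf)

text \<open>By \<open>euler_linear_form\<close> the inner bracket is again linear in \<open>p\<close> and \<open>q\<close>, so the double bracket is a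
  scalar. The \<open>i\<close>-th pair contributes \<open>l i * c i\<close> twice, with equal signs: once through \<open>q i\<close>, once through
  \<open>p i\<close>.\<close>

lemma linear_form_euler:
  assumes "(\<Sum>i\<in>I. l i * c i) = 0"
  shows "bracket (linear_form c) (bracket (linear_form c) (euler l)) = \<zero>"
proof -
  have "bracket (linear_form c) (bracket (euler l) (linear_form c)) = (\<Oplus>i\<in>I. (2 * (l i * c i)) \<odot> \<one>)"
    unfolding euler_linear_form
    by (subst bracket_finsum_right)
      (auto intro!: finsum_cong' closed simp: scal_closed p_closed q_closed bracket_linear closed
        linear_form_q linear_form_p scal_scal scal_add_left[symmetric] mult.commute)
  also have "\<dots> = \<zero>"
    by (simp add: finsum_scal_left sum_distrib_left[symmetric] assms scal_zero_left)
  finally have "bracket (linear_form c) (\<ominus> bracket (linear_form c) (euler l)) = \<zero>"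
    using bracket_swap[OF closed] by simp
  moreover have "\<ominus> bracket (linear_form c) (euler l) = (- 1) \<odot> bracket (linear_form c) (euler l)"
    by (simp add: scal_uminus scal_one bracket_closed closed)
  ultimately have "(- 1) \<odot> bracket (linear_form c) (bracket (linear_form c) (euler l)) = \<zero>"
    by (simp add: bracket_linear bracket_closed closed)
  then have "(- 1) \<odot> ((- 1) \<odot> bracket (linear_form c) (bracket (linear_form c) (euler l))) = \<zero>"
    by (simp add: scal_zero_right)
  then show ?thesis by (simp add: scal_scal scal_one bracket_closed closed)
qed

text \<open>The conditions on \<open>l\<close> say that the eigenvalues \<open>l i\<close> of the \<open>q i\<close> and \<open>- l i\<close> of the \<open>p i\<close> are pairwise
  distinct, so \<open>linear_form c\<close> can be split into its eigencomponents \<open>q i\<close> and \<open>c i \<odot> p i\<close>.\<close>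

lemma euler_linear_form_generate:
  assumes R: "unital_subalgebra R A" and vw: "euler l \<in> R" "linear_form c \<in> R"
    and c: "\<And>i. i \<in> I \<Longrightarrow> c i \<noteq> 0" and l: "inj_on l I" "\<And>i j. i \<in> I \<Longrightarrow> j \<in> I \<Longrightarrow> l i \<noteq> - l j"
    and i: "i \<in> I"
  shows "q i \<in> R" "p i \<in> R"
proof -
  \<comment> \<open>The eigenvectors are indexed by two copies of \<open>I\<close>: the left one for \<open>q\<close>, the right one for \<open>p\<close>.\<close>
  define e where "e = case_sum q (\<lambda>i. c i \<odot> p i)"
  define \<mu> where "\<mu> = case_sum l (\<lambda>i. - l i)"
  have e: "e j \<in> carrier A" if "j \<in> I <+> I" for j
    using that by (auto simp: e_def p_closed q_closed scal_closed)
  have eigen: "bracket (euler l) (e j) = \<mu> j \<odot> e j" if "j \<in> I <+> I" for j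
    using that by (auto simp: e_def \<mu>_def euler_q euler_p closed bracket_linear p_closed scal_scal mult.commute)
  have inj: "inj_on \<mu> (I <+> I)"
  proof (rule inj_onI)
    fix x y assume "x \<in> I <+> I" "y \<in> I <+> I" "\<mu> x = \<mu> y"
    then show "x = y"
      using inj_onD[OF l(1)] l(2) l(2)[symmetric] by (cases x; cases y) (auto simp: \<mu>_def)
  qed
  have "(\<Oplus>j\<in>I <+> I. e j) = (\<Oplus>j\<in>Inl ` I. e j) \<oplus> (\<Oplus>j\<in>Inr ` I. e j)"
    unfolding Plus_def using finite_I e by (intro finsum_Un_disjoint) auto
  also have "\<dots> = (\<Oplus>i\<in>I. q i) \<oplus> (\<Oplus>i\<in>I. c i \<odot> p i)"
    using e by (subst (1 2) finsum_reindex) (auto simp: e_def)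
  also have "\<dots> = linear_form c"
    unfolding linear_form_def by (subst finsum_addf) (auto simp: p_closed q_closed scal_closed)
  finally have sum: "(\<Oplus>j\<in>I <+> I. e j) \<in> R" using vw(2) by simp
  have eR: "e j \<in> R" if "j \<in> I <+> I" for j
    by (rule eigencomponents_in_subalgebra[OF R vw(1) _ e eigen inj sum that]) (use finite_I in auto)
  show "q i \<in> R" using eR[OF InlI[OF i]] by (simp add: e_def)
  have "c i \<odot> p i \<in> R" using eR[OF InrI[OF i]] by (simp add: e_def)
  then have "inverse (c i) \<odot> (c i \<odot> p i) \<in> R" by (rule unital_subalgebraD(5)[OF R])
  then show "p i \<in> R" using c[OF i] by (simp add: scal_scal scal_one p_closed i)
qed

end

section \<open>Weyl algebras\<close>

lemma weyl_relations_closed: "weyl_relations r \<subseteq> carrier (free_assoc (weyl_gens r) :: ('k::field, _) module)"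
proof -
  interpret F: assoc_algebra "free_assoc (weyl_gens r) :: ('k, _) module" by (rule free_assoc_algebra)
  have "P i \<in> weyl_gens r" "Q i \<in> weyl_gens r" if "i \<in> {1..r}" for i
    using that by (auto simp: weyl_gens_def)
  then show ?thesis
    unfolding weyl_relations_def Let_def
    by (auto intro!: F.minus_closed F.bracket_closed assoc_var_closed simp del: One_nat_def)
qed

lemma weyl_assoc_algebra: "assoc_algebra (weyl_algebra r)"
  unfolding weyl_algebra_def by (rule quotient_assoc_algebra[OF free_assoc_algebra weyl_relations_closed])

definition weyl_var :: "nat \<Rightarrow> weyl_gen \<Rightarrow> (weyl_gen list \<Rightarrow>\<^sub>0 'k::field) set" where
  "weyl_var r x = class_by (free_assoc (weyl_gens r)) (weyl_relations r) (assoc_var x)"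

lemma weyl_quotient:
  "algebra_quotient (free_assoc (weyl_gens r) :: ('k::field, _) module) (weyl_relations r)"
  using free_assoc_algebra weyl_relations_closed
  by (intro algebra_quotient.intro algebra_quotient_axioms.intro) (auto simp: assoc_algebra_def)

lemma weyl_canonical_pairs:
  "canonical_pairs (weyl_algebra r :: ('k::field, _) module) {1..r} (\<lambda>i. weyl_var r (P i)) (\<lambda>i. weyl_var r (Q i))"
proof -
  let ?F = "free_assoc (weyl_gens r) :: ('k, _) module" and ?W = "weyl_algebra r :: ('k, _) module"
  interpret F: assoc_algebra ?F by (rule free_assoc_algebra)
  interpret W: assoc_algebra ?W by (rule weyl_assoc_algebra)
  interpret Q: algebra_quotient ?F "weyl_relations r" by (rule weyl_quotient)
  let ?cls = "class_by ?F (weyl_relations r)"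
  have hom: "?cls \<in> nonassoc_hom ?F ?W" using Q.class_hom by (simp add: weyl_algebra_def)
  interpret cls: abelian_group_hom ?F ?W ?cls
    by (rule nonassoc_hom_abelian_group_hom[OF F.nonassoc_algebra_axioms W.nonassoc_algebra_axioms hom])
  have zero: "?cls x = \<zero>\<^bsub>?W\<^esub>" if "x \<in> weyl_relations r" for x
    using Q.class_gens[OF that] by (simp add: weyl_algebra_def)
  have one: "?cls \<one>\<^bsub>?F\<^esub> = \<one>\<^bsub>?W\<^esub>" by (simp add: weyl_algebra_def Q.quot_one)
  have gen: "assoc_var (P i) \<in> carrier ?F" "assoc_var (Q i) \<in> carrier ?F" if "i \<in> {1..r}" for i
    using that by (auto intro!: assoc_var_closed simp: weyl_gens_def)
  have comm: "commutator ?W (weyl_var r x) (weyl_var r y) = ?cls (commutator ?F (assoc_var x) (assoc_var y))"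
    if "assoc_var x \<in> carrier ?F" "assoc_var y \<in> carrier ?F" for x y
    unfolding weyl_var_def
    by (rule hom_commutator[OF F.nonassoc_algebra_axioms W.nonassoc_algebra_axioms hom that, symmetric])
  have closed: "weyl_var r x \<in> carrier ?W" if "assoc_var x \<in> carrier ?F" for x
    unfolding weyl_var_def by (rule nonassoc_homD(1)[OF hom that])
  show ?thesis
  proof unfold_locales
    fix i j assume ij: "i \<in> {1..r}" "j \<in> {1..r}"
    let ?d = "if i = j then \<one>\<^bsub>?F\<^esub> else \<zero>\<^bsub>?F\<^esub>"
    have d: "?d \<in> carrier ?F" by simp
    have "commutator ?F (assoc_var (P i)) (assoc_var (Q j)) \<ominus>\<^bsub>?F\<^esub> ?d \<in> weyl_relations r"
      unfolding weyl_relations_def Let_def using ij by blast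
    then have "?cls (commutator ?F (assoc_var (P i)) (assoc_var (Q j))) \<ominus>\<^bsub>?W\<^esub> ?cls ?d = \<zero>\<^bsub>?W\<^esub>"
      using zero cls.hom_minus[OF F.bracket_closed[OF gen(1)[OF ij(1)] gen(2)[OF ij(2)]] d] by metis
    then have "?cls (commutator ?F (assoc_var (P i)) (assoc_var (Q j))) = ?cls ?d"
      by (rule W.minus_zero_imp_eq[rotated 2])
        (intro cls.hom_closed F.bracket_closed gen ij d)+
    then show "commutator ?W (weyl_var r (P i)) (weyl_var r (Q j)) = (if i = j then \<one>\<^bsub>?W\<^esub> else \<zero>\<^bsub>?W\<^esub>)"
      using comm[OF gen(1)[OF ij(1)] gen(2)[OF ij(2)]] one cls.hom_zero by (simp split: if_splits)
    have "commutator ?F (assoc_var (P i)) (assoc_var (P j)) \<in> weyl_relations r"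
      "commutator ?F (assoc_var (Q i)) (assoc_var (Q j)) \<in> weyl_relations r"
      unfolding weyl_relations_def Let_def using ij by blast+
    then show "commutator ?W (weyl_var r (P i)) (weyl_var r (P j)) = \<zero>\<^bsub>?W\<^esub>"
      "commutator ?W (weyl_var r (Q i)) (weyl_var r (Q j)) = \<zero>\<^bsub>?W\<^esub>"
      using comm[OF gen(1)[OF ij(1)] gen(1)[OF ij(2)]] comm[OF gen(2)[OF ij(1)] gen(2)[OF ij(2)]] zero
      by simp_all
  qed (use closed gen in auto)
qed

lemma weyl_generated:
  assumes R: "unital_subalgebra R (weyl_algebra r :: ('k::field, _) module)"
    and gens: "\<And>i. i \<in> {1..r} \<Longrightarrow> weyl_var r (P i) \<in> R" "\<And>i. i \<in> {1..r} \<Longrightarrow> weyl_var r (Q i) \<in> R"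
  shows "R = carrier (weyl_algebra r)"
proof -
  let ?F = "free_assoc (weyl_gens r) :: ('k, _) module"
  interpret Q: algebra_quotient ?F "weyl_relations r" by (rule weyl_quotient)
  let ?cls = "class_by ?F (weyl_relations r)"
  have "unital_subalgebra {x \<in> carrier ?F. ?cls x \<in> R} ?F"
    using hom_preimage_subalgebra[OF free_assoc_algebra Q.class_hom] R
    by (simp add: weyl_algebra_def Q.quot_one)
  then have "{x \<in> carrier ?F. ?cls x \<in> R} = carrier ?F"
  proof (rule free_assoc_generated)
    fix x assume x: "x \<in> weyl_gens r"
    then have "weyl_var r x \<in> R" using gens by (auto simp: weyl_gens_def)
    then show "assoc_var x \<in> {x \<in> carrier ?F. ?cls x \<in> R}"
      using assoc_var_closed[OF x] by (simp add: weyl_var_def)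
  qed
  then have "carrier (weyl_algebra r) \<subseteq> R"
    unfolding weyl_algebra_def Q.quot_carrier by blast
  then show ?thesis using R by (auto simp: unital_subalgebra_def)
qed

text \<open>The weights \<open>1, \<dots>, r\<close> and their negatives are distinct in characteristic zero. The coefficients
  \<open>c i = 1 / i\<close> for \<open>i \<ge> 2\<close> each contribute \<open>1\<close> to \<open>\<Sum>\<^sub>i i * c i\<close>, and \<open>c 1 = 1 - r\<close> balances them. It vanishes
  for \<open>r = 1\<close>, where the pair \<open>p, q\<close> itself serves instead.\<close>

lemma weyl_two_generators:
  assumes r: "r \<ge> 1"
  obtains v w where "v \<in> carrier (weyl_algebra r :: ('k::field_char_0, _) module)"
    "w \<in> carrier (weyl_algebra r)"
    "commutator (weyl_algebra r) w (commutator (weyl_algebra r) w v) = \<zero>\<^bsub>weyl_algebra r\<^esub>"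
    "\<And>R. unital_subalgebra R (weyl_algebra r) \<Longrightarrow> v \<in> R \<Longrightarrow> w \<in> R \<Longrightarrow> R = carrier (weyl_algebra r)"
proof -
  let ?W = "weyl_algebra r :: ('k, _) module"
  interpret canonical_pairs ?W "{1..r}" "\<lambda>i. weyl_var r (P i)" "\<lambda>i. weyl_var r (Q i)"
    by (rule weyl_canonical_pairs)
  show thesis
  proof (cases "r = 1")
    case True
    then have one: "1 \<in> {1..r}" and only: "\<And>i. i \<in> {1..r} \<Longrightarrow> i = 1" by auto
    show thesis
    proof (rule that)
      show "weyl_var r (P 1) \<in> carrier ?W" "weyl_var r (Q 1) \<in> carrier ?W"
        using p_closed[OF one] q_closed[OF one] by auto
      have "bracket (weyl_var r (Q 1)) (weyl_var r (P 1)) = (- 1) \<odot>\<^bsub>?W\<^esub> \<one>\<^bsub>?W\<^esub>"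
        using qp[OF one one] by (simp add: scal_uminus scal_one)
      moreover have "bracket (weyl_var r (Q 1)) \<one>\<^bsub>?W\<^esub> = \<zero>\<^bsub>?W\<^esub>"
        using q_closed[OF one] by (simp add: commutator_def a_minus_def r_neg)
      ultimately show "bracket (weyl_var r (Q 1)) (bracket (weyl_var r (Q 1)) (weyl_var r (P 1))) = \<zero>\<^bsub>?W\<^esub>"
        using q_closed[OF one] by (simp add: bracket_linear scal_zero_right)
      show "R = carrier ?W"
        if "unital_subalgebra R ?W" "weyl_var r (P 1) \<in> R" "weyl_var r (Q 1) \<in> R" for R
        by (rule weyl_generated[OF that(1)]) (use that(2,3) only in auto)
    qed
  next
    case False
    then have r2: "r \<ge> 2" using r by simp
    define l :: "nat \<Rightarrow> 'k" where "l = of_nat"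
    define c :: "nat \<Rightarrow> 'k" where "c i = (if i = 1 then - of_nat (r - 1) else 1 / of_nat i)" for i
    have "(\<Sum>i\<in>{1..r}. l i * c i) = l 1 * c 1 + (\<Sum>i\<in>{2..r}. l i * c i)"
      using r by (simp add: sum.atLeast_Suc_atMost numeral_2_eq_2)
    also have "(\<Sum>i\<in>{2..r}. l i * c i) = (\<Sum>i\<in>{2..r}. 1)"
      by (intro sum.cong) (auto simp: l_def c_def)
    finally have sum: "(\<Sum>i\<in>{1..r}. l i * c i) = 0"
      using r by (simp add: l_def c_def)
    have c0: "c i \<noteq> 0" if "i \<in> {1..r}" for i
      using that r2 by (auto simp: c_def)
    have inj: "inj_on l {1..r}" by (auto simp: inj_on_def l_def)
    have opp: "l i \<noteq> - l j" if "i \<in> {1..r}" "j \<in> {1..r}" for i j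
    proof
      assume "l i = - l j"
      then have "(of_nat (i + j) :: 'k) = 0" by (simp add: l_def)
      then show False using that by (simp only: of_nat_eq_0_iff) simp
    qed
    show thesis
    proof (rule that[OF closed(1)[of l] closed(2)[of c]])
      show "bracket (linear_form c) (bracket (linear_form c) (euler l)) = \<zero>\<^bsub>?W\<^esub>"
        by (rule linear_form_euler[OF sum])
      show "R = carrier ?W"
        if "unital_subalgebra R ?W" "euler l \<in> R" "linear_form c \<in> R" for R
        using euler_linear_form_generate[OF that c0 inj opp] by (intro weyl_generated[OF that(1)]) auto
    qed
  qed
qed

section \<open>The epimorphism\<close>

theorem theorem1p1:
  fixes n r :: nat
  assumes "n \<ge> 3" and "r \<ge> 1"
  shows "\<exists>\<phi> \<in> alg_hom (yang_mills n :: ('k :: {alg_closed_field, field_char_0}, _) module)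
                        (weyl_algebra r).
           \<phi> ` carrier (yang_mills n) = carrier (weyl_algebra r)"
proof -
  let ?Y = "yang_mills n :: ('k, _) module" and ?W = "weyl_algebra r :: ('k, _) module"
  interpret W: assoc_algebra ?W by (rule weyl_assoc_algebra)
  obtain v w where vw: "v \<in> carrier ?W" "w \<in> carrier ?W"
    and wwv: "commutator ?W w (commutator ?W w v) = \<zero>\<^bsub>?W\<^esub>"
    and gen: "\<And>R. unital_subalgebra R ?W \<Longrightarrow> v \<in> R \<Longrightarrow> w \<in> R \<Longrightarrow> R = carrier ?W"
    using weyl_two_generators[OF assms(2)] by metis
  obtain \<iota> :: 'k where \<iota>: "\<iota> * \<iota> = - 1"
    using nth_root_exists[of 2 "- 1 :: 'k"] by (auto simp: power2_eq_square)
  define a where "a = W.null_ym_tuple \<iota> v w"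
  have a: "a i \<in> carrier ?W" for i unfolding a_def by (rule W.null_ym_tuple_closed[OF vw])
  have ym: "(\<Oplus>\<^bsub>?W\<^esub>i\<in>{1..n}. commutator ?W (a i) (commutator ?W (a i) (a j))) = \<zero>\<^bsub>?W\<^esub>" for j
    unfolding a_def by (rule W.null_ym_tuple_relation[OF vw \<iota> assms(1) wwv])
  obtain g where g: "g \<in> nonassoc_hom (lie_yang_mills n) (commutator_algebra ?W)"
    "\<And>i. i \<in> {1..n} \<Longrightarrow> g (lie_ym_var n i) = a i"
    by (rule lie_yang_mills_hom[of ?W n a, OF W.assoc_algebra_axioms a ym]) blast
  note L = lie_yang_mills_algebra[of n, where 'a = 'k]
  obtain f where f: "f \<in> nonassoc_hom ?Y ?W" "f \<one>\<^bsub>?Y\<^esub> = \<one>\<^bsub>?W\<^esub>"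
    "\<And>x. x \<in> carrier (lie_yang_mills n) \<Longrightarrow> f (env_var (lie_yang_mills n) x) = g x"
    using univ_env_hom[OF L W.assoc_algebra_axioms g(1)] unfolding yang_mills_def by blast
  have Y: "assoc_algebra ?Y" unfolding yang_mills_def by (rule univ_env_algebra[OF L])
  have img: "a i \<in> f ` carrier ?Y" if i: "i \<in> {1..n}" for i
  proof -
    note x = lie_ym_var_closed[OF i, where 'a = 'k]
    have "f (env_var (lie_yang_mills n) (lie_ym_var n i)) = a i"
      using f(3)[OF x] g(2)[OF i] by simp
    then show ?thesis using env_var_closed[OF L x] unfolding yang_mills_def by force
  qed
  have "f ` carrier ?Y = carrier ?W"
    by (rule gen[OF hom_image_subalgebra[OF Y f(1,2)]])
      (use img[of 1] img[of 3] assms(1) in \<open>simp_all add: a_def W.null_ym_tuple_def\<close>)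
  moreover have "f \<in> alg_hom ?Y ?W"
    using nonassoc_homD[OF f(1)] f(2) by (auto simp: alg_hom_def ring_hom_def)
  ultimately show ?thesis by blast
qed

end
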